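(* If an operator space $X$ is a right but not a left $M$-ideal in its second dual, then $X^*$ is a left but not a right $L$-summand in its second dual.
   Context: Spaces are regarded as subspaces of their second duals via the canonical embeddings. For an operator space $X$, a left $M$-projection on $X$ is a linear idempotent $P$ on $X$ such that $x\mapsto\begin{bmatrix}P(x)\\ x-P(x)\end{bmatrix}$ is a complete isometry from $X$ into $C_2(X)$ (columns of length two over $X$); a right $M$-projection is a linear idempotent $P$ on $X$ such that $x\mapsto[\,P(x)\ \ x-P(x)\,]$ is a complete isometry from $X$ into $R_2(X)$ (rows of length two). A closed subspace $J$ of $X$ is a right (resp. left) $M$-ideal in $X$ if $J^{\perp\perp}$ is the range of a left (resp. right) $M$-projection on $X^{**}$. A right (resp. left) $L$-projection on $X$ is a bounded linear idempotent $Q$ on $X$ such that $Q^*$ is a left (resp. right) $M$-projection on $X^*$. A subspace of $X$ is a left (resp. right) $L$-summand of $X$ if it is the range of a right (resp. left) $L$-projection on $X$. *)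

theory Defs
  imports "HOL-Analysis.Analysis"
begin

section \<open>Complex normed spaces\<close>

class scaleC =
  fixes scaleC :: "complex \<Rightarrow> 'a \<Rightarrow> 'a"  (infixr \<open>*\<^sub>C\<close> 75)

class complex_normed_vector = real_normed_vector + scaleC +
  assumes scaleC_add_right: "a *\<^sub>C (x + y) = a *\<^sub>C x + a *\<^sub>C y"
    and scaleC_add_left: "(a + b) *\<^sub>C x = a *\<^sub>C x + b *\<^sub>C x"
    and scaleC_scaleC: "a *\<^sub>C (b *\<^sub>C x) = (a * b) *\<^sub>C x"
    and scaleC_of_real: "complex_of_real r *\<^sub>C x = r *\<^sub>R x"
    and norm_scaleC: "norm (a *\<^sub>C x) = cmod a * norm x"

global_interpretation complex_vector: vector_space "scaleC :: complex \<Rightarrow> 'a \<Rightarrow> 'a::complex_normed_vector"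
proof
  show "1 *\<^sub>C x = x" for x :: 'a
    using scaleC_of_real[of 1 x] by simp
qed (simp_all add: scaleC_add_right scaleC_add_left scaleC_scaleC)

instantiation complex :: complex_normed_vector
begin

definition scaleC_complex :: "complex \<Rightarrow> complex \<Rightarrow> complex" where
  "scaleC_complex = (*)"

instance
  by standard (simp_all add: scaleC_complex_def algebra_simps norm_mult scaleR_conv_of_real)

end

definition clinear :: "('a::complex_normed_vector \<Rightarrow> 'b::complex_normed_vector) \<Rightarrow> bool" where
  "clinear = Vector_Spaces.linear scaleC scaleC"

definition bounded_clinear :: "('a::complex_normed_vector \<Rightarrow> 'b::complex_normed_vector) \<Rightarrow> bool" where
  "bounded_clinear f \<longleftrightarrow> clinear f \<and> bounded_linear f"

lemma clinear_iff:
  "clinear f \<longleftrightarrow> (\<forall>x y. f (x + y) = f x + f y) \<and> (\<forall>c x. f (c *\<^sub>C x) = c *\<^sub>C f x)"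
  unfolding clinear_def Vector_Spaces.linear_iff
  using complex_vector.vector_space_axioms[where 'a='a] complex_vector.vector_space_axioms[where 'a='b]
  by simp

lemma bounded_clinear_iff:
  "bounded_clinear f \<longleftrightarrow> bounded_linear f \<and> (\<forall>c x. f (c *\<^sub>C x) = c *\<^sub>C f x)"
  unfolding bounded_clinear_def clinear_iff
  using linear_add[OF bounded_linear.linear, of f] by blast


section \<open>Operator norms of scalar matrices\<close>

text \<open>Arbitrary finite index sets are allowed, so that a matrix in \<open>M\<^sub>n(M\<^sub>m)\<close> can be indexed
  by pairs instead of being flattened.\<close>

definition opnorm :: "'i set \<Rightarrow> 'j set \<Rightarrow> ('i \<Rightarrow> 'j \<Rightarrow> complex) \<Rightarrow> real" where
  "opnorm I J A =
     (SUP v\<in>{v. L2_set (\<lambda>j. cmod (v j)) J \<le> 1}. L2_set (\<lambda>i. cmod (\<Sum>j\<in>J. A i j * v j)) I)"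

lemma opnorm_bdd:
  assumes "finite I" "finite J"
  shows "bdd_above ((\<lambda>v. L2_set (\<lambda>i. cmod (\<Sum>j\<in>J. A i j * v j)) I) ` {v. L2_set (\<lambda>j. cmod (v j)) J \<le> 1})"
proof (rule bdd_aboveI2)
  fix v assume "v \<in> {v. L2_set (\<lambda>j. cmod (v j)) J \<le> 1}"
  then have v: "cmod (v j) \<le> 1" if "j \<in> J" for j
    using member_le_L2_set[OF assms(2) that, of "\<lambda>j. cmod (v j)"] by simp
  have "L2_set (\<lambda>i. cmod (\<Sum>j\<in>J. A i j * v j)) I \<le> (\<Sum>i\<in>I. cmod (\<Sum>j\<in>J. A i j * v j))"
    by (rule L2_set_le_sum) simp
  also have "\<dots> \<le> (\<Sum>i\<in>I. \<Sum>j\<in>J. cmod (A i j))"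
    by (intro sum_mono sum_norm_le) (simp add: norm_mult mult_left_le v)
  finally show "L2_set (\<lambda>i. cmod (\<Sum>j\<in>J. A i j * v j)) I \<le> (\<Sum>i\<in>I. \<Sum>j\<in>J. cmod (A i j))" .
qed

lemma opnorm_nonneg:
  assumes "finite I" "finite J"
  shows "0 \<le> opnorm I J A"
proof -
  have "L2_set (\<lambda>i. cmod (\<Sum>j\<in>J. A i j * 0)) I \<le> opnorm I J A"
    unfolding opnorm_def by (rule cSUP_upper2[OF opnorm_bdd[OF assms], where x="\<lambda>_. 0"])
      (auto simp: L2_set_def)
  then show ?thesis by (simp add: L2_set_def)
qed

lemma opnorm_bound:
  assumes "finite I" "finite J"
  shows "L2_set (\<lambda>i. cmod (\<Sum>j\<in>J. A i j * v j)) I \<le> opnorm I J A * L2_set (\<lambda>j. cmod (v j)) J"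
proof (cases "L2_set (\<lambda>j. cmod (v j)) J = 0")
  case True
  then have "\<forall>j\<in>J. v j = 0" using assms by (simp add: L2_set_eq_0_iff)
  then show ?thesis using True by (simp add: L2_set_def)
next
  case False
  define r where "r = L2_set (\<lambda>j. cmod (v j)) J"
  have r: "r > 0" using False by (simp add: r_def order_less_le)
  define w where "w j = of_real (1/r) * v j" for j
  have "L2_set (\<lambda>j. cmod (w j)) J = (1/r) * r"
    unfolding w_def r_def norm_mult using r
    by (subst L2_set_right_distrib) (auto simp: norm_divide)
  then have "L2_set (\<lambda>j. cmod (w j)) J \<le> 1" using r by simp
  then have "L2_set (\<lambda>i. cmod (\<Sum>j\<in>J. A i j * w j)) I \<le> opnorm I J A"
    unfolding opnorm_def by (intro cSUP_upper opnorm_bdd assms) auto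
  moreover have "(\<Sum>j\<in>J. A i j * w j) = of_real (1/r) * (\<Sum>j\<in>J. A i j * v j)" for i
    unfolding w_def by (simp add: sum_distrib_left algebra_simps)
  then have "L2_set (\<lambda>i. cmod (\<Sum>j\<in>J. A i j * w j)) I = (1/r) * L2_set (\<lambda>i. cmod (\<Sum>j\<in>J. A i j * v j)) I"
    using r by (subst L2_set_right_distrib) (auto simp: norm_mult norm_divide)
  ultimately show ?thesis using r by (simp add: field_simps r_def)
qed

lemma opnorm_le:
  assumes "\<And>v. L2_set (\<lambda>i. cmod (\<Sum>j\<in>J. A i j * v j)) I \<le> c * L2_set (\<lambda>j. cmod (v j)) J" "0 \<le> c"
  shows "opnorm I J A \<le> c"
  unfolding opnorm_def
proof (rule cSUP_least)
  have "(\<lambda>_. 0) \<in> {v. L2_set (\<lambda>j. cmod (v j)) J \<le> 1}" by (simp add: L2_set_def)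
  then show "{v. L2_set (\<lambda>j. cmod (v j)) J \<le> 1} \<noteq> {}" by (metis empty_iff)
  fix v assume "v \<in> {v. L2_set (\<lambda>j. cmod (v j)) J \<le> 1}"
  then show "L2_set (\<lambda>i. cmod (\<Sum>j\<in>J. A i j * v j)) I \<le> c"
    using assms(1)[of v] mult_left_mono[of "L2_set (\<lambda>j. cmod (v j)) J" 1 c] assms(2) by simp
qed

lemma opnorm_cong:
  assumes "I = I'" "J = J'" "\<And>i j. i \<in> I' \<Longrightarrow> j \<in> J' \<Longrightarrow> A i j = B i j"
  shows "opnorm I J A = opnorm I' J' B"
proof -
  have "(\<Sum>j\<in>J. A i j * v j) = (\<Sum>j\<in>J'. B i j * v j)" if "i \<in> I'" for i v
    using assms that by (intro sum.cong) auto
  then have "L2_set (\<lambda>i. cmod (\<Sum>j\<in>J. A i j * v j)) I = L2_set (\<lambda>i. cmod (\<Sum>j\<in>J'. B i j * v j)) I'" for v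
    using assms(1) by (intro L2_set_cong) auto
  then show ?thesis unfolding opnorm_def by (simp only: assms(2))
qed

lemma opnorm_triangle:
  assumes "finite I" "finite J"
  shows "opnorm I J (\<lambda>i j. A i j + B i j) \<le> opnorm I J A + opnorm I J B"
proof (rule opnorm_le)
  fix v
  have "L2_set (\<lambda>i. cmod (\<Sum>j\<in>J. (A i j + B i j) * v j)) I
     \<le> L2_set (\<lambda>i. cmod (\<Sum>j\<in>J. A i j * v j) + cmod (\<Sum>j\<in>J. B i j * v j)) I"
    by (rule L2_set_mono) (auto simp: distrib_right sum.distrib norm_triangle_ineq)
  also have "\<dots> \<le> L2_set (\<lambda>i. cmod (\<Sum>j\<in>J. A i j * v j)) I + L2_set (\<lambda>i. cmod (\<Sum>j\<in>J. B i j * v j)) I"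
    by (rule L2_set_triangle_ineq)
  also have "\<dots> \<le> (opnorm I J A + opnorm I J B) * L2_set (\<lambda>j. cmod (v j)) J"
    using opnorm_bound[OF assms, of A v] opnorm_bound[OF assms, of B v] by (simp add: distrib_right)
  finally show "L2_set (\<lambda>i. cmod (\<Sum>j\<in>J. (A i j + B i j) * v j)) I
     \<le> (opnorm I J A + opnorm I J B) * L2_set (\<lambda>j. cmod (v j)) J" .
qed (simp add: opnorm_nonneg assms)

lemma opnorm_scale_le:
  assumes "finite I" "finite J"
  shows "opnorm I J (\<lambda>i j. c * A i j) \<le> cmod c * opnorm I J A"
proof (rule opnorm_le)
  fix v
  have "L2_set (\<lambda>i. cmod (\<Sum>j\<in>J. c * A i j * v j)) I = cmod c * L2_set (\<lambda>i. cmod (\<Sum>j\<in>J. A i j * v j)) I"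
    by (subst L2_set_right_distrib) (simp_all add: mult.assoc sum_distrib_left[symmetric] norm_mult)
  also have "\<dots> \<le> cmod c * opnorm I J A * L2_set (\<lambda>j. cmod (v j)) J"
    using opnorm_bound[OF assms, of A v] by (simp add: mult.assoc mult_left_mono)
  finally show "L2_set (\<lambda>i. cmod (\<Sum>j\<in>J. c * A i j * v j)) I \<le> cmod c * opnorm I J A * L2_set (\<lambda>j. cmod (v j)) J" .
qed (simp add: opnorm_nonneg assms)

lemma opnorm_entry:
  assumes "finite I" "finite J" "i \<in> I" "j \<in> J"
  shows "cmod (A i j) \<le> opnorm I J A"
proof -
  define v where "v k = (if k = j then 1 else 0 :: complex)" for k
  have "(\<Sum>k\<in>J. A i k * v k) = A i j" for i
    unfolding v_def using assms by (simp add: if_distrib sum.delta cong: if_cong)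
  moreover have "L2_set (\<lambda>k. cmod (v k)) J = 1"
  proof -
    have "(\<Sum>k\<in>J. (cmod (v k))\<^sup>2) = (\<Sum>k\<in>J. if k = j then 1 else 0)"
      by (rule sum.cong) (auto simp: v_def)
    also have "\<dots> = 1" using assms by simp
    finally show ?thesis by (simp add: L2_set_def)
  qed
  ultimately have "L2_set (\<lambda>i. cmod (A i j)) I \<le> opnorm I J A"
    using opnorm_bound[OF assms(1,2), of A v] by simp
  then show ?thesis using member_le_L2_set[OF assms(1,3), of "\<lambda>i. cmod (A i j)"] by simp
qed

lemma opnorm_col_le: "opnorm I {..<1::nat} (\<lambda>i j. v i) \<le> L2_set (\<lambda>i. cmod (v i)) I"
proof (rule opnorm_le)
  fix w :: "nat \<Rightarrow> complex"
  have "L2_set (\<lambda>i. cmod (\<Sum>j<1. v i * w j)) I = L2_set (\<lambda>i. cmod (v i) * cmod (w 0)) I"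
    by (simp add: norm_mult)
  also have "\<dots> = L2_set (\<lambda>i. cmod (v i)) I * cmod (w 0)"
    by (simp only: L2_set_left_distrib norm_ge_zero)
  finally show "L2_set (\<lambda>i. cmod (\<Sum>j<1. v i * w j)) I
    \<le> L2_set (\<lambda>i. cmod (v i)) I * L2_set (\<lambda>j. cmod (w j)) {..<1::nat}"
    by (simp add: lessThan_Suc)
qed simp

lemma opnorm_row_le:
  "opnorm {..<1::nat} J (\<lambda>i j. v j) \<le> L2_set (\<lambda>j. cmod (v j)) J"
proof (rule opnorm_le)
  fix w
  have "cmod (\<Sum>j\<in>J. v j * w j) \<le> (\<Sum>j\<in>J. \<bar>cmod (v j)\<bar> * \<bar>cmod (w j)\<bar>)"
    by (rule sum_norm_le) (simp add: norm_mult)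
  also have "\<dots> \<le> L2_set (\<lambda>j. cmod (v j)) J * L2_set (\<lambda>j. cmod (w j)) J"
    by (rule L2_set_mult_ineq)
  finally show "L2_set (\<lambda>i. cmod (\<Sum>j\<in>J. v j * w j)) {..<1::nat}
    \<le> L2_set (\<lambda>j. cmod (v j)) J * L2_set (\<lambda>j. cmod (w j)) J" by (simp add: lessThan_Suc)
qed simp

lemma L2_set_Times:
  "L2_set g (A \<times> B) = L2_set (\<lambda>i. L2_set (\<lambda>k. g (i, k)) B) A"
  unfolding L2_set_def by (simp add: sum_nonneg sum.cartesian_product case_prod_unfold)

lemma L2_set_Times_swap:
  "L2_set g (A \<times> B) = L2_set (\<lambda>k. L2_set (\<lambda>i. g (i, k)) A) B"
proof -
  have "(\<Sum>x\<in>A \<times> B. (g x)\<^sup>2) = (\<Sum>i\<in>A. \<Sum>k\<in>B. (g (i, k))\<^sup>2)"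
    by (simp add: sum.cartesian_product case_prod_unfold)
  also have "\<dots> = (\<Sum>k\<in>B. \<Sum>i\<in>A. (g (i, k))\<^sup>2)"
    by (rule sum.swap)
  finally show ?thesis unfolding L2_set_def by (simp add: sum_nonneg)
qed

lemma L2_set_sum: "L2_set (\<lambda>k. \<Sum>j\<in>J. a j k) K \<le> (\<Sum>j\<in>J. L2_set (a j) K)"
proof (induction J rule: infinite_finite_induct)
  case (insert j J)
  have "L2_set (\<lambda>k. a j k + (\<Sum>j\<in>J. a j k)) K \<le> L2_set (a j) K + L2_set (\<lambda>k. \<Sum>j\<in>J. a j k) K"
    by (rule L2_set_triangle_ineq)
  then show ?case using insert by simp
qed (simp_all add: L2_set_def)

lemma L2_set_reindex: "inj_on g I \<Longrightarrow> L2_set f (g ` I) = L2_set (\<lambda>i. f (g i)) I"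
  unfolding L2_set_def by (simp add: sum.reindex o_def)

lemma opnorm_mono:
  assumes "finite I" "finite J" "I' \<subseteq> I" "J' \<subseteq> J"
  shows "opnorm I' J' A \<le> opnorm I J A"
proof (rule opnorm_le)
  fix v :: "_ \<Rightarrow> complex"
  define w where "w j = (if j \<in> J' then v j else 0)" for j
  have "(\<Sum>j\<in>J. A i j * w j) = (\<Sum>j\<in>J'. A i j * v j)" for i
    using assms by (intro sum.mono_neutral_cong_right) (auto simp: w_def)
  moreover have "(\<Sum>j\<in>J. (cmod (w j))\<^sup>2) = (\<Sum>j\<in>J'. (cmod (v j))\<^sup>2)"
    using assms by (intro sum.mono_neutral_cong_right) (auto simp: w_def)
  then have "L2_set (\<lambda>j. cmod (w j)) J = L2_set (\<lambda>j. cmod (v j)) J'"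
    by (simp add: L2_set_def)
  ultimately have "L2_set (\<lambda>i. cmod (\<Sum>j\<in>J'. A i j * v j)) I \<le> opnorm I J A * L2_set (\<lambda>j. cmod (v j)) J'"
    using opnorm_bound[OF assms(1,2), of A w] by simp
  moreover have "L2_set (\<lambda>i. cmod (\<Sum>j\<in>J'. A i j * v j)) I' \<le> L2_set (\<lambda>i. cmod (\<Sum>j\<in>J'. A i j * v j)) I"
    unfolding L2_set_def using assms by (intro real_sqrt_le_mono sum_mono2) auto
  ultimately show "L2_set (\<lambda>i. cmod (\<Sum>j\<in>J'. A i j * v j)) I' \<le> opnorm I J A * L2_set (\<lambda>j. cmod (v j)) J'"
    by linarith
qed (simp add: opnorm_nonneg assms)

lemma opnorm_reindex:
  assumes "finite I" "finite J" "inj_on g I" "inj_on h J"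
  shows "opnorm (g ` I) (h ` J) A = opnorm I J (\<lambda>i j. A (g i) (h j))"
proof (rule antisym)
  show "opnorm (g ` I) (h ` J) A \<le> opnorm I J (\<lambda>i j. A (g i) (h j))"
  proof (rule opnorm_le)
    fix v
    show "L2_set (\<lambda>i. cmod (\<Sum>j\<in>h ` J. A i j * v j)) (g ` I)
        \<le> opnorm I J (\<lambda>i j. A (g i) (h j)) * L2_set (\<lambda>j. cmod (v j)) (h ` J)"
      using opnorm_bound[OF assms(1,2), of "\<lambda>i j. A (g i) (h j)" "\<lambda>j. v (h j)"] assms
      by (simp add: L2_set_reindex sum.reindex o_def)
  qed (simp add: opnorm_nonneg assms)
next
  show "opnorm I J (\<lambda>i j. A (g i) (h j)) \<le> opnorm (g ` I) (h ` J) A"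
  proof (rule opnorm_le)
    fix v :: "_ \<Rightarrow> complex"
    define w where "w j = v (inv_into J h j)" for j
    have w: "w (h j) = v j" if "j \<in> J" for j
      using that assms(4) by (simp add: w_def)
    have "(\<Sum>j\<in>h ` J. A i j * w j) = (\<Sum>j\<in>J. A i (h j) * v j)" for i
      using assms(4) w by (simp add: sum.reindex o_def)
    moreover have "L2_set (\<lambda>j. cmod (w j)) (h ` J) = L2_set (\<lambda>j. cmod (v j)) J"
      using assms(4) w by (simp add: L2_set_reindex cong: L2_set_cong_simp)
    ultimately show "L2_set (\<lambda>i. cmod (\<Sum>j\<in>J. A (g i) (h j) * v j)) I
        \<le> opnorm (g ` I) (h ` J) A * L2_set (\<lambda>j. cmod (v j)) J"
      using opnorm_bound[of "g ` I" "h ` J" A w] assms by (simp add: L2_set_reindex)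
  qed (simp add: opnorm_nonneg assms)
qed

lemma opnorm_block_diag:
  assumes fin: "finite I" "finite J" "finite I'" "finite J'"
    and disj: "I \<inter> I' = {}" "J \<inter> J' = {}"
    and zero: "\<And>i j. i \<in> I \<Longrightarrow> j \<in> J' \<Longrightarrow> A i j = 0" "\<And>i j. i \<in> I' \<Longrightarrow> j \<in> J \<Longrightarrow> A i j = 0"
  shows "opnorm (I \<union> I') (J \<union> J') A = max (opnorm I J A) (opnorm I' J' A)"
proof (rule antisym)
  define c where "c = max (opnorm I J A) (opnorm I' J' A)"
  have c: "opnorm I J A \<le> c" "opnorm I' J' A \<le> c" "0 \<le> c"
    using opnorm_nonneg[OF fin(1,2), of A] by (auto simp: c_def)
  have "opnorm (I \<union> I') (J \<union> J') A \<le> c"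
  proof (rule opnorm_le)
    fix v :: "'b \<Rightarrow> complex"
    define y where "y i = (\<Sum>j\<in>J \<union> J'. A i j * v j)" for i
    define V V' where "V = L2_set (\<lambda>j. cmod (v j)) J" and "V' = L2_set (\<lambda>j. cmod (v j)) J'"
    have y: "y i = (\<Sum>j\<in>J. A i j * v j)" if "i \<in> I" for i
      unfolding y_def using fin zero that by (intro sum.mono_neutral_right) auto
    have y': "y i = (\<Sum>j\<in>J'. A i j * v j)" if "i \<in> I'" for i
      unfolding y_def using fin zero that by (intro sum.mono_neutral_right) auto
    have "L2_set (\<lambda>i. cmod (y i)) I = L2_set (\<lambda>i. cmod (\<Sum>j\<in>J. A i j * v j)) I"
      by (rule L2_set_cong) (simp_all add: y)
    also have "\<dots> \<le> opnorm I J A * V"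
      unfolding V_def by (rule opnorm_bound[OF fin(1,2)])
    also have "\<dots> \<le> c * V" by (rule mult_right_mono) (simp_all add: c V_def)
    finally have 1: "L2_set (\<lambda>i. cmod (y i)) I \<le> c * V" .
    have "L2_set (\<lambda>i. cmod (y i)) I' = L2_set (\<lambda>i. cmod (\<Sum>j\<in>J'. A i j * v j)) I'"
      by (rule L2_set_cong) (simp_all add: y')
    also have "\<dots> \<le> opnorm I' J' A * V'"
      unfolding V'_def by (rule opnorm_bound[OF fin(3,4)])
    also have "\<dots> \<le> c * V'" by (rule mult_right_mono) (simp_all add: c V'_def)
    finally have 2: "L2_set (\<lambda>i. cmod (y i)) I' \<le> c * V'" .
    have "(L2_set (\<lambda>i. cmod (y i)) (I \<union> I'))\<^sup>2
        = (L2_set (\<lambda>i. cmod (y i)) I)\<^sup>2 + (L2_set (\<lambda>i. cmod (y i)) I')\<^sup>2"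
      using fin disj by (simp add: L2_set_def sum_nonneg sum.union_disjoint)
    also have "\<dots> \<le> (c * V)\<^sup>2 + (c * V')\<^sup>2"
      by (intro add_mono power_mono 1 2) simp_all
    also have "\<dots> = (c * L2_set (\<lambda>j. cmod (v j)) (J \<union> J'))\<^sup>2"
      using fin disj
      by (simp add: V_def V'_def power_mult_distrib L2_set_def sum_nonneg sum.union_disjoint distrib_left)
    finally show "L2_set (\<lambda>i. cmod (\<Sum>j\<in>J \<union> J'. A i j * v j)) (I \<union> I')
        \<le> c * L2_set (\<lambda>j. cmod (v j)) (J \<union> J')"
      unfolding y_def by (rule power2_le_imp_le) (simp add: c)
  qed (rule c)
  then show "opnorm (I \<union> I') (J \<union> J') A \<le> max (opnorm I J A) (opnorm I' J' A)"
    by (simp only: c_def)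
  show "max (opnorm I J A) (opnorm I' J' A) \<le> opnorm (I \<union> I') (J \<union> J') A"
    using fin by (intro max.boundedI opnorm_mono) auto
qed

lemma opnorm_bound_amplified:
  assumes "finite I" "finite J"
  shows "L2_set (\<lambda>(i, p). cmod (\<Sum>k\<in>J. A i k * t (k, p))) (I \<times> P)
    \<le> opnorm I J A * L2_set (\<lambda>q. cmod (t q)) (J \<times> P)"
proof -
  have "L2_set (\<lambda>(i, p). cmod (\<Sum>k\<in>J. A i k * t (k, p))) (I \<times> P)
      = L2_set (\<lambda>p. L2_set (\<lambda>i. cmod (\<Sum>k\<in>J. A i k * t (k, p))) I) P"
    by (subst L2_set_Times_swap) simp
  also have "\<dots> \<le> L2_set (\<lambda>p. opnorm I J A * L2_set (\<lambda>k. cmod (t (k, p))) J) P"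
    by (rule L2_set_mono) (simp_all add: opnorm_bound assms)
  also have "\<dots> = opnorm I J A * L2_set (\<lambda>q. cmod (t q)) (J \<times> P)"
    by (subst L2_set_Times_swap) (rule L2_set_right_distrib[symmetric], simp add: opnorm_nonneg assms)
  finally show ?thesis .
qed


section \<open>Operator spaces\<close>

text \<open>A matrix in \<open>M\<^sub>n(X)\<close> is a function \<open>nat \<Rightarrow> nat \<Rightarrow> X\<close> of which only the entries with both
  indices below \<open>n\<close> matter.\<close>

definition (in zero) dsum :: "nat \<Rightarrow> (nat \<Rightarrow> nat \<Rightarrow> 'a) \<Rightarrow> (nat \<Rightarrow> nat \<Rightarrow> 'a) \<Rightarrow> nat \<Rightarrow> nat \<Rightarrow> 'a" where
  "dsum m x y = (\<lambda>i j. if i < m \<and> j < m then x i j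
                       else if m \<le> i \<and> m \<le> j then y (i - m) (j - m) else 0)"

text \<open>Abstract operator spaces in the sense of Ruan; \<open>mnorm n\<close> is the norm of \<open>M\<^sub>n(X)\<close>. Completeness
  is not required.\<close>

class operator_space = complex_normed_vector +
  fixes mnorm :: "nat \<Rightarrow> (nat \<Rightarrow> nat \<Rightarrow> 'a) \<Rightarrow> real"
  assumes mnorm_cong: "(\<And>i j. i < n \<Longrightarrow> j < n \<Longrightarrow> x i j = y i j) \<Longrightarrow> mnorm n x = mnorm n y"
    and mnorm_eq_0_iff: "mnorm n x = 0 \<longleftrightarrow> (\<forall>i<n. \<forall>j<n. x i j = 0)"
    and mnorm_triangle: "mnorm n (\<lambda>i j. x i j + y i j) \<le> mnorm n x + mnorm n y"
    and mnorm_scaleC: "mnorm n (\<lambda>i j. c *\<^sub>C x i j) = cmod c * mnorm n x"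
    and mnorm_1: "mnorm 1 (\<lambda>_ _. z) = norm z"
    and mnorm_dsum: "mnorm (m + n) (dsum m x y) = max (mnorm m x) (mnorm n y)"
    and mnorm_mult: "mnorm n (\<lambda>i j. \<Sum>k<m. \<Sum>l<m. (\<alpha> i k * \<beta> l j) *\<^sub>C x k l)
                      \<le> opnorm {..<n} {..<m} \<alpha> * mnorm m x * opnorm {..<m} {..<n} \<beta>"

lemma mnorm_0_mat: "mnorm n (\<lambda>i j. 0) = (0::real)"
  by (simp add: mnorm_eq_0_iff)

lemma mnorm_nonneg: "0 \<le> mnorm n (x :: nat \<Rightarrow> nat \<Rightarrow> 'a::operator_space)"
proof -
  have "0 = mnorm n (\<lambda>i j. x i j + (-1) *\<^sub>C x i j)"
    by (simp add: mnorm_0_mat complex_vector.scale_minus_left)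
  also have "\<dots> \<le> mnorm n x + mnorm n x"
    using mnorm_triangle[of n x "\<lambda>i j. (-1) *\<^sub>C x i j"] by (simp only: mnorm_scaleC) simp
  finally show ?thesis by simp
qed


section \<open>The dual operator space\<close>

typedef (overloaded) 'a dual = "{f :: 'a::complex_normed_vector \<Rightarrow> complex. bounded_clinear f}"
  morphisms dual_apply Abs_dual
  by (rule exI[of _ "\<lambda>_. 0"]) (simp add: bounded_clinear_iff bounded_linear_zero scaleC_complex_def)

setup_lifting type_definition_dual

lemma dual_eqI: "(\<And>x. dual_apply f x = dual_apply g x) \<Longrightarrow> f = g"
  by (rule dual_apply_inject[THEN iffD1]) (rule ext)

lemma bounded_clinear_dual_apply: "bounded_clinear (dual_apply f)"
  using dual_apply[of f] by simp

lemma bounded_linear_dual_apply: "bounded_linear (dual_apply f)"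
  by (rule bounded_clinear_dual_apply[unfolded bounded_clinear_def, THEN conjunct2])

lemma dual_apply_scaleC: "dual_apply f (c *\<^sub>C x) = c * dual_apply f x"
  using bounded_clinear_dual_apply[of f] by (simp add: bounded_clinear_iff scaleC_complex_def)

lemma dual_apply_sum: "dual_apply f (\<Sum>i\<in>I. g i) = (\<Sum>i\<in>I. dual_apply f (g i))"
  by (rule linear_sum[OF bounded_linear.linear[OF bounded_linear_dual_apply]])

instantiation dual :: (complex_normed_vector) complex_normed_vector
begin

lift_definition norm_dual :: "'a dual \<Rightarrow> real" is onorm .

lift_definition zero_dual :: "'a dual" is "\<lambda>x. 0"
  by (simp add: bounded_clinear_iff bounded_linear_zero scaleC_complex_def)

lift_definition plus_dual :: "'a dual \<Rightarrow> 'a dual \<Rightarrow> 'a dual" is "\<lambda>f g x. f x + g x"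
  by (simp add: bounded_clinear_iff bounded_linear_add scaleC_add_right)

lift_definition minus_dual :: "'a dual \<Rightarrow> 'a dual \<Rightarrow> 'a dual" is "\<lambda>f g x. f x - g x"
  by (simp add: bounded_clinear_iff bounded_linear_sub complex_vector.scale_right_diff_distrib)

lift_definition uminus_dual :: "'a dual \<Rightarrow> 'a dual" is "\<lambda>f x. - f x"
  by (simp add: bounded_clinear_iff bounded_linear_minus)

lift_definition scaleC_dual :: "complex \<Rightarrow> 'a dual \<Rightarrow> 'a dual" is "\<lambda>c f x. c * f x"
  by (simp add: bounded_clinear_iff bounded_linear_const_mult scaleC_complex_def)

definition scaleR_dual :: "real \<Rightarrow> 'a dual \<Rightarrow> 'a dual" where
  "scaleR_dual r f = complex_of_real r *\<^sub>C f"

definition dist_dual :: "'a dual \<Rightarrow> 'a dual \<Rightarrow> real" where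
  "dist_dual f g = norm (f - g)"

definition sgn_dual :: "'a dual \<Rightarrow> 'a dual" where
  "sgn_dual f = inverse (norm f) *\<^sub>R f"

definition uniformity_dual :: "('a dual \<times> 'a dual) filter" where
  "uniformity_dual = (INF e\<in>{0 <..}. principal {(x, y). dist x y < e})"

definition open_dual :: "'a dual set \<Rightarrow> bool" where
  "open_dual S = (\<forall>x\<in>S. \<forall>\<^sub>F (x', y) in uniformity. x' = x \<longrightarrow> y \<in> S)"

lemma norm_scaleC_dual: "norm (c *\<^sub>C f) = cmod c * norm f" for f :: "'a dual"
proof -
  have le: "norm (c *\<^sub>C f) \<le> cmod c * norm f" for c and f :: "'a dual"
    unfolding norm_dual.rep_eq scaleC_dual.rep_eq
  proof (rule onorm_bound)
    have bl: "bounded_linear (dual_apply f)" by (rule bounded_linear_dual_apply)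
    then show "0 \<le> cmod c * onorm (dual_apply f)" by (simp add: onorm_pos_le)
    fix x
    show "norm (c * dual_apply f x) \<le> cmod c * onorm (dual_apply f) * norm x"
      using onorm[OF bl, of x] by (simp add: norm_mult mult.assoc mult_left_mono)
  qed
  have zero: "0 *\<^sub>C f = 0" by transfer simp
  have n0: "norm (0 :: 'a dual) = 0" by transfer (rule onorm_zero)
  show ?thesis
  proof (cases "c = 0")
    case False
    have "f = (1/c) *\<^sub>C (c *\<^sub>C f)" using False by transfer simp
    then have "norm f \<le> cmod (1/c) * norm (c *\<^sub>C f)" using le[of "1/c" "c *\<^sub>C f"] by simp
    then show ?thesis using le[of c f] False by (simp add: norm_divide field_simps)
  qed (simp add: zero n0)
qed

instance
proof
  fix f g h :: "'a dual" and a b :: real and c d :: complex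
  show "f + g + h = f + (g + h)" "f + g = g + f" "0 + f = f" "- f + f = 0" "f - g = f + - g"
    by (transfer; simp add: fun_eq_iff)+
  show "a *\<^sub>R (f + g) = a *\<^sub>R f + a *\<^sub>R g" "(a + b) *\<^sub>R f = a *\<^sub>R f + b *\<^sub>R f"
    "a *\<^sub>R b *\<^sub>R f = (a * b) *\<^sub>R f" "1 *\<^sub>R f = f"
    unfolding scaleR_dual_def by (transfer; simp add: fun_eq_iff algebra_simps)+
  show "dist f g = norm (f - g)" by (rule dist_dual_def)
  show "sgn f = inverse (norm f) *\<^sub>R f" by (rule sgn_dual_def)
  show "(uniformity :: ('a dual \<times> 'a dual) filter) = (INF e\<in>{0 <..}. principal {(x, y). dist x y < e})"
    by (rule uniformity_dual_def)
  show "open U = (\<forall>x\<in>U. \<forall>\<^sub>F (x', y) in uniformity. x' = x \<longrightarrow> y \<in> U)" for U :: "'a dual set"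
    by (rule open_dual_def)
  show "(norm f = 0) = (f = 0)"
    by transfer (auto simp: bounded_clinear_def onorm_eq_0 fun_eq_iff)
  show "norm (f + g) \<le> norm f + norm g"
    by transfer (simp add: bounded_clinear_def onorm_triangle)
  show "norm (a *\<^sub>R f) = \<bar>a\<bar> * norm f"
    unfolding scaleR_dual_def by (simp add: norm_scaleC_dual)
  show "c *\<^sub>C (f + g) = c *\<^sub>C f + c *\<^sub>C g" "(c + d) *\<^sub>C f = c *\<^sub>C f + d *\<^sub>C f"
    "c *\<^sub>C d *\<^sub>C f = (c * d) *\<^sub>C f"
    by (transfer; simp add: fun_eq_iff algebra_simps)+
  show "complex_of_real a *\<^sub>C f = a *\<^sub>R f" by (simp add: scaleR_dual_def)
  show "norm (c *\<^sub>C f) = cmod c * norm f" by (rule norm_scaleC_dual)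
qed

end

lemma dual_apply_bound: "cmod (dual_apply f x) \<le> norm f * norm x"
  unfolding norm_dual.rep_eq by (rule onorm[OF bounded_linear_dual_apply])

text \<open>The norm in \<open>M\<^sub>n(M\<^sub>m)\<close> of the matrix pairing \<open>[f\<^sub>i\<^sub>j(x\<^sub>k\<^sub>l)]\<close> of a matrix of functionals with
  a matrix over the space.\<close>

definition pairing_norm ::
  "nat \<Rightarrow> nat \<Rightarrow> (nat \<Rightarrow> nat \<Rightarrow> 'a::complex_normed_vector dual) \<Rightarrow> (nat \<Rightarrow> nat \<Rightarrow> 'a) \<Rightarrow> real" where
  "pairing_norm n m F x =
     opnorm ({..<n} \<times> {..<m}) ({..<n} \<times> {..<m}) (\<lambda>(i, k) (j, l). dual_apply (F i j) (x k l))"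

lemma opnorm_functional_le:
  fixes f :: "'a::operator_space dual"
  shows "opnorm {..<m} {..<m} (\<lambda>k l. dual_apply f (x k l)) \<le> norm f * mnorm m x"
proof (rule opnorm_le)
  fix v
  define y where "y k = (\<Sum>l<m. dual_apply f (x k l) * v l)" for k
  define z where "z = (\<Sum>k<m. \<Sum>l<m. (cnj (y k) * v l) *\<^sub>C x k l)"
  define r where "r = L2_set (\<lambda>k. cmod (y k)) {..<m}"
  define V where "V = L2_set (\<lambda>l. cmod (v l)) {..<m}"
  have "dual_apply f z = (\<Sum>k<m. cnj (y k) * y k)"
    unfolding z_def dual_apply_sum dual_apply_scaleC
    by (subst (3) y_def) (simp add: sum_distrib_left mult_ac)
  also have "\<dots> = of_real (\<Sum>k<m. (cmod (y k))\<^sup>2)"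
    by (simp only: of_real_sum complex_norm_square mult.commute)
  also have "(\<Sum>k<m. (cmod (y k))\<^sup>2) = r * r"
    by (simp add: r_def L2_set_def sum_nonneg)
  finally have "r * r = cmod (dual_apply f z)"
    by (simp add: norm_mult r_def)
  also have "\<dots> \<le> norm f * norm z" by (rule dual_apply_bound)
  also have "norm z = mnorm 1 (\<lambda>i j. z)" by (simp only: mnorm_1)
  also have "\<dots> \<le> opnorm {..<1::nat} {..<m} (\<lambda>i k. cnj (y k)) * mnorm m x * opnorm {..<m} {..<1::nat} (\<lambda>l j. v l)"
    unfolding z_def by (rule mnorm_mult)
  also have "\<dots> \<le> (r * mnorm m x) * V"
  proof (intro mult_mono)
    show "opnorm {..<1::nat} {..<m} (\<lambda>i k. cnj (y k)) \<le> r"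
      using opnorm_row_le[of "{..<m}" "\<lambda>k. cnj (y k)"] by (simp add: r_def)
    show "opnorm {..<m} {..<1::nat} (\<lambda>l j. v l) \<le> V"
      using opnorm_col_le[of "{..<m}" v] by (simp add: V_def)
  qed (simp_all add: mnorm_nonneg opnorm_nonneg r_def)
  finally have "r * r \<le> norm f * (r * mnorm m x * V)" by (simp add: mult_left_mono)
  then have "r * r \<le> r * (norm f * mnorm m x * V)" by (simp only: mult_ac)
  moreover have "0 \<le> norm f * mnorm m x * V" by (simp add: mnorm_nonneg V_def)
  moreover have "0 \<le> r" by (simp add: r_def)
  ultimately have "r \<le> norm f * mnorm m x * V"
    by (cases "r = 0") simp_all
  then show "L2_set (\<lambda>i. cmod (\<Sum>j<m. dual_apply f (x i j) * v j)) {..<m}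
      \<le> norm f * mnorm m x * L2_set (\<lambda>j. cmod (v j)) {..<m}"
    by (simp only: r_def y_def V_def)
qed (simp add: mnorm_nonneg)

lemma pairing_norm_nonneg: "0 \<le> pairing_norm n m F x"
  unfolding pairing_norm_def by (simp add: opnorm_nonneg)

lemma pairing_norm_le:
  fixes x :: "nat \<Rightarrow> nat \<Rightarrow> 'a::operator_space"
  shows "pairing_norm n m F x \<le> (\<Sum>i<n. \<Sum>j<n. norm (F i j)) * mnorm m x"
  unfolding pairing_norm_def
proof (rule opnorm_le)
  fix v :: "nat \<times> nat \<Rightarrow> complex"
  define V where "V = L2_set (\<lambda>j. cmod (v j)) ({..<n} \<times> {..<m})"
  define a where "a i j k = cmod (\<Sum>l<m. dual_apply (F i j) (x k l) * v (j, l))" for i j k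
  have V: "L2_set (\<lambda>l. cmod (v (j, l))) {..<m} \<le> V" if "j < n" for j
    using member_le_L2_set[of "{..<n}" j "\<lambda>j. L2_set (\<lambda>l. cmod (v (j, l))) {..<m}"] that
    unfolding V_def L2_set_Times by simp
  have "(\<Sum>q\<in>{..<n} \<times> {..<m}. (case p of (i, k) \<Rightarrow> \<lambda>(j, l). dual_apply (F i j) (x k l)) q * v q)
     = (\<Sum>j<n. \<Sum>l<m. dual_apply (F (fst p) j) (x (snd p) l) * v (j, l))" for p
    by (simp add: sum.cartesian_product case_prod_unfold)
  then have "L2_set (\<lambda>p. cmod (\<Sum>q\<in>{..<n} \<times> {..<m}.
       (case p of (i, k) \<Rightarrow> \<lambda>(j, l). dual_apply (F i j) (x k l)) q * v q)) ({..<n} \<times> {..<m})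
     = L2_set (\<lambda>i. L2_set (\<lambda>k. cmod (\<Sum>j<n. \<Sum>l<m. dual_apply (F i j) (x k l) * v (j, l))) {..<m}) {..<n}"
    by (simp add: L2_set_Times)
  also have "\<dots> \<le> (\<Sum>i<n. L2_set (\<lambda>k. cmod (\<Sum>j<n. \<Sum>l<m. dual_apply (F i j) (x k l) * v (j, l))) {..<m})"
    by (rule L2_set_le_sum) simp
  also have "\<dots> \<le> (\<Sum>i<n. L2_set (\<lambda>k. \<Sum>j<n. a i j k) {..<m})"
    by (intro sum_mono L2_set_mono) (simp_all add: a_def norm_sum)
  also have "\<dots> \<le> (\<Sum>i<n. \<Sum>j<n. L2_set (a i j) {..<m})"
    by (intro sum_mono L2_set_sum)
  also have "\<dots> \<le> (\<Sum>i<n. \<Sum>j<n. norm (F i j) * mnorm m x * V)"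
  proof (intro sum_mono)
    fix i j assume ij: "i \<in> {..<n}" "j \<in> {..<n}"
    have "L2_set (a i j) {..<m} \<le> opnorm {..<m} {..<m} (\<lambda>k l. dual_apply (F i j) (x k l))
        * L2_set (\<lambda>l. cmod (v (j, l))) {..<m}"
      unfolding a_def by (rule opnorm_bound) simp_all
    also have "\<dots> \<le> norm (F i j) * mnorm m x * V"
      using ij by (intro mult_mono opnorm_functional_le V) (simp_all add: mnorm_nonneg)
    finally show "L2_set (a i j) {..<m} \<le> norm (F i j) * mnorm m x * V" .
  qed
  also have "\<dots> = (\<Sum>i<n. \<Sum>j<n. norm (F i j)) * mnorm m x * V"
    by (simp add: sum_distrib_right)
  finally show "L2_set (\<lambda>p. cmod (\<Sum>q\<in>{..<n} \<times> {..<m}.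
       (case p of (i, k) \<Rightarrow> \<lambda>(j, l). dual_apply (F i j) (x k l)) q * v q)) ({..<n} \<times> {..<m})
     \<le> (\<Sum>i<n. \<Sum>j<n. norm (F i j)) * mnorm m x * L2_set (\<lambda>j. cmod (v j)) ({..<n} \<times> {..<m})"
    by (simp only: V_def)
qed (simp add: mnorm_nonneg sum_nonneg)

lemma pairing_norm_dsum:
  "pairing_norm (p + q) m (dsum p F G) x = max (pairing_norm p m F x) (pairing_norm q m G x)"
proof -
  let ?A = "\<lambda>(i, k) (j, l). dual_apply (dsum p F G i j) (x k l)"
  define g where "g = (\<lambda>(i::nat, k::nat). (i + p, k))"
  have im: "g ` ({..<q} \<times> {..<m}) = {p..<p + q} \<times> {..<m}"
  proof -
    have "(i, k) \<in> g ` ({..<q} \<times> {..<m})" if "p \<le> i" "i < p + q" "k < m" for i k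
      using that by (intro image_eqI[of _ _ "(i - p, k)"]) (auto simp: g_def)
    then show ?thesis by (auto simp: g_def)
  qed
  have un: "{..<p + q} \<times> {..<m} = {..<p} \<times> {..<m} \<union> {p..<p + q} \<times> {..<m}" by auto
  have z: "dual_apply 0 y = 0" for y :: 'a by transfer simp
  have "opnorm ({..<p + q} \<times> {..<m}) ({..<p + q} \<times> {..<m}) ?A
     = max (opnorm ({..<p} \<times> {..<m}) ({..<p} \<times> {..<m}) ?A)
           (opnorm ({p..<p + q} \<times> {..<m}) ({p..<p + q} \<times> {..<m}) ?A)"
    unfolding un by (rule opnorm_block_diag) (auto simp: dsum_def z)
  also have "opnorm ({..<p} \<times> {..<m}) ({..<p} \<times> {..<m}) ?A = pairing_norm p m F x"
    unfolding pairing_norm_def by (rule opnorm_cong) (auto simp: dsum_def)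
  also have "opnorm ({p..<p + q} \<times> {..<m}) ({p..<p + q} \<times> {..<m}) ?A = pairing_norm q m G x"
    unfolding im[symmetric] pairing_norm_def
    by (subst opnorm_reindex) (auto simp: g_def inj_on_def dsum_def intro!: opnorm_cong)
  finally show ?thesis unfolding pairing_norm_def .
qed

lemma sum_reorder:
  "(\<Sum>j\<in>J. \<Sum>b\<in>B. \<Sum>k\<in>K. \<Sum>l\<in>L. H j b k l) = (\<Sum>k\<in>K. \<Sum>l\<in>L. \<Sum>b\<in>B. \<Sum>j\<in>J. H j b k l)"
proof -
  have "(\<Sum>j\<in>J. \<Sum>b\<in>B. \<Sum>k\<in>K. \<Sum>l\<in>L. H j b k l) = (\<Sum>b\<in>B. \<Sum>j\<in>J. \<Sum>k\<in>K. \<Sum>l\<in>L. H j b k l)"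
    by (rule sum.swap)
  also have "\<dots> = (\<Sum>b\<in>B. \<Sum>k\<in>K. \<Sum>j\<in>J. \<Sum>l\<in>L. H j b k l)"
    by (intro sum.cong refl sum.swap)
  also have "\<dots> = (\<Sum>k\<in>K. \<Sum>b\<in>B. \<Sum>j\<in>J. \<Sum>l\<in>L. H j b k l)"
    by (rule sum.swap)
  also have "\<dots> = (\<Sum>k\<in>K. \<Sum>b\<in>B. \<Sum>l\<in>L. \<Sum>j\<in>J. H j b k l)"
    by (intro sum.cong refl sum.swap)
  also have "\<dots> = (\<Sum>k\<in>K. \<Sum>l\<in>L. \<Sum>b\<in>B. \<Sum>j\<in>J. H j b k l)"
    by (intro sum.cong refl sum.swap)
  finally show ?thesis .
qed

lemma pairing_norm_mult:
  "pairing_norm n m (\<lambda>i j. \<Sum>k<r. \<Sum>l<r. (\<alpha> i k * \<beta> l j) *\<^sub>C F k l) x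
     \<le> opnorm {..<n} {..<r} \<alpha> * pairing_norm r m F x * opnorm {..<r} {..<n} \<beta>"
  unfolding pairing_norm_def
proof (rule opnorm_le)
  fix v :: "nat \<times> nat \<Rightarrow> complex"
  let ?A = "\<lambda>(i, k) (j, l). dual_apply (F i j) (x k l)"
  let ?N = "{..<n} \<times> {..<m}" and ?R = "{..<r} \<times> {..<m}"
  define u where "u = (\<lambda>(l, b). \<Sum>j<n. \<beta> l j * v (j, b))"
  define t where "t = (\<lambda>p. \<Sum>q\<in>?R. ?A p q * u q)"
  have add: "dual_apply (f + g) y = dual_apply f y + dual_apply g y" for f g :: "'a dual" and y
    by transfer simp
  have zero: "dual_apply 0 y = 0" for y :: 'a by transfer simp
  have sum: "dual_apply (\<Sum>i\<in>I. f i) y = (\<Sum>i\<in>I. dual_apply (f i) y)" for f :: "nat \<Rightarrow> 'a dual" and I y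
    by (induction I rule: infinite_finite_induct) (simp_all add: add zero)
  have scale: "dual_apply (c *\<^sub>C f) y = c * dual_apply f y" for c and f :: "'a dual" and y
    by transfer simp
  have entry: "(\<Sum>q\<in>?N. (case (i, a) of (i, k) \<Rightarrow> \<lambda>(j, l).
        dual_apply (\<Sum>k'<r. \<Sum>l'<r. (\<alpha> i k' * \<beta> l' j) *\<^sub>C F k' l') (x k l)) q * v q)
      = (\<Sum>k<r. \<alpha> i k * t (k, a))" for i a
  proof -
    have "(\<Sum>q\<in>?N. (case (i, a) of (i, k) \<Rightarrow> \<lambda>(j, l).
        dual_apply (\<Sum>k'<r. \<Sum>l'<r. (\<alpha> i k' * \<beta> l' j) *\<^sub>C F k' l') (x k l)) q * v q)
      = (\<Sum>j<n. \<Sum>b<m. \<Sum>k<r. \<Sum>l<r. \<alpha> i k * (dual_apply (F k l) (x a b) * (\<beta> l j * v (j, b))))"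
      by (simp add: sum scale sum.cartesian_product' case_prod_unfold sum_distrib_left sum_distrib_right mult_ac)
    also have "\<dots> = (\<Sum>k<r. \<Sum>l<r. \<Sum>b<m. \<Sum>j<n. \<alpha> i k * (dual_apply (F k l) (x a b) * (\<beta> l j * v (j, b))))"
      by (rule sum_reorder)
    also have "\<dots> = (\<Sum>k<r. \<alpha> i k * t (k, a))"
      by (simp add: t_def u_def sum.cartesian_product' case_prod_unfold sum_distrib_left)
    finally show ?thesis .
  qed
  have "L2_set (\<lambda>p. cmod (\<Sum>q\<in>?N. (case p of (i, k) \<Rightarrow> \<lambda>(j, l).
        dual_apply (\<Sum>k'<r. \<Sum>l'<r. (\<alpha> i k' * \<beta> l' j) *\<^sub>C F k' l') (x k l)) q * v q)) ?N
      = L2_set (\<lambda>(i, a). cmod (\<Sum>k<r. \<alpha> i k * t (k, a))) ?N"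
  proof (rule L2_set_cong[OF refl])
    fix p :: "nat \<times> nat"
    obtain i a where p: "p = (i, a)" by (cases p)
    show "cmod (\<Sum>q\<in>?N. (case p of (i, k) \<Rightarrow> \<lambda>(j, l).
        dual_apply (\<Sum>k'<r. \<Sum>l'<r. (\<alpha> i k' * \<beta> l' j) *\<^sub>C F k' l') (x k l)) q * v q)
      = (case p of (i, a) \<Rightarrow> cmod (\<Sum>k<r. \<alpha> i k * t (k, a)))"
      unfolding p entry by simp
  qed
  also have "\<dots> \<le> opnorm {..<n} {..<r} \<alpha> * L2_set (\<lambda>p. cmod (t p)) ?R"
    by (rule opnorm_bound_amplified) simp_all
  also have "L2_set (\<lambda>p. cmod (t p)) ?R \<le> opnorm ?R ?R ?A * L2_set (\<lambda>p. cmod (u p)) ?R"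
    unfolding t_def by (rule opnorm_bound) simp_all
  also have "L2_set (\<lambda>p. cmod (u p)) ?R = L2_set (\<lambda>(l, b). cmod (\<Sum>j<n. \<beta> l j * v (j, b))) ?R"
    by (rule L2_set_cong) (auto simp: u_def)
  also have "\<dots> \<le> opnorm {..<r} {..<n} \<beta> * L2_set (\<lambda>q. cmod (v q)) ?N"
    by (rule opnorm_bound_amplified) simp_all
  finally show "L2_set (\<lambda>p. cmod (\<Sum>q\<in>?N. (case p of (i, k) \<Rightarrow> \<lambda>(j, l).
        dual_apply (\<Sum>k'<r. \<Sum>l'<r. (\<alpha> i k' * \<beta> l' j) *\<^sub>C F k' l') (x k l)) q * v q)) ?N
      \<le> opnorm {..<n} {..<r} \<alpha> * opnorm ?R ?R ?A * opnorm {..<r} {..<n} \<beta> * L2_set (\<lambda>q. cmod (v q)) ?N"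
    by (simp add: mult.assoc mult_left_mono opnorm_nonneg)
qed (simp add: opnorm_nonneg)

text \<open>\<open>M\<^sub>n(X\<^sup>*)\<close> is normed as \<open>CB(X, M\<^sub>n)\<close>: the norm of \<open>[f\<^sub>i\<^sub>j]\<close> is the completely bounded norm of
  \<open>x \<mapsto> [f\<^sub>i\<^sub>j(x)]\<close>.\<close>

instantiation dual :: (operator_space) operator_space
begin

definition mnorm_dual :: "nat \<Rightarrow> (nat \<Rightarrow> nat \<Rightarrow> 'a dual) \<Rightarrow> real" where
  "mnorm_dual n F = (SUP (m, x)\<in>{(m, x). mnorm m x \<le> 1}. pairing_norm n m F x)"

lemma pairing_norm_le_mnorm:
  fixes x :: "nat \<Rightarrow> nat \<Rightarrow> 'a"
  assumes "mnorm m x \<le> 1"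
  shows "pairing_norm n m F x \<le> mnorm n F"
proof -
  have "bdd_above ((\<lambda>(m, x). pairing_norm n m F x) ` {(m, x). mnorm m x \<le> 1})"
  proof (rule bdd_aboveI2)
    fix p :: "nat \<times> (nat \<Rightarrow> nat \<Rightarrow> 'a)" assume "p \<in> {(m, x). mnorm m x \<le> 1}"
    moreover obtain m x where "p = (m, x)" by (cases p)
    ultimately have "pairing_norm n m F x \<le> (\<Sum>i<n. \<Sum>j<n. norm (F i j)) * mnorm m x" "mnorm m x \<le> 1"
      using pairing_norm_le by auto
    moreover have "(\<Sum>i<n. \<Sum>j<n. norm (F i j)) * mnorm m x \<le> (\<Sum>i<n. \<Sum>j<n. norm (F i j)) * 1"
      using \<open>mnorm m x \<le> 1\<close> by (intro mult_left_mono sum_nonneg) simp_all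
    ultimately show "(\<lambda>(m, x). pairing_norm n m F x) p \<le> (\<Sum>i<n. \<Sum>j<n. norm (F i j))"
      using \<open>p = (m, x)\<close> by simp
  qed
  then show ?thesis
    unfolding mnorm_dual_def using assms by (intro cSUP_upper2[where x="(m, x)"]) auto
qed

lemma mnorm_dual_le:
  assumes "\<And>m (x :: nat \<Rightarrow> nat \<Rightarrow> 'a). mnorm m x \<le> 1 \<Longrightarrow> pairing_norm n m F x \<le> c"
  shows "mnorm n F \<le> c"
  unfolding mnorm_dual_def
proof (rule cSUP_least)
  have "(0, \<lambda>i j. 0) \<in> {(m, x :: nat \<Rightarrow> nat \<Rightarrow> 'a). mnorm m x \<le> 1}"
    by (simp add: mnorm_0_mat)
  then show "{(m, x :: nat \<Rightarrow> nat \<Rightarrow> 'a). mnorm m x \<le> 1} \<noteq> {}" by (metis empty_iff)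
qed (use assms in auto)

lemma mnorm_dual_nonneg: "0 \<le> mnorm n (F :: nat \<Rightarrow> nat \<Rightarrow> 'a dual)"
proof -
  have "pairing_norm n 0 F (\<lambda>i j. 0) \<le> mnorm n F"
    by (rule pairing_norm_le_mnorm) (simp add: mnorm_0_mat)
  then show ?thesis using pairing_norm_nonneg[of n 0 F "\<lambda>i j. 0"] by linarith
qed

lemma norm_le_mnorm_dual:
  fixes F :: "nat \<Rightarrow> nat \<Rightarrow> 'a dual"
  assumes "i < n" "j < n"
  shows "norm (F i j) \<le> mnorm n F"
  unfolding norm_dual.rep_eq
proof (rule onorm_bound)
  fix x :: 'a
  show "cmod (dual_apply (F i j) x) \<le> mnorm n F * norm x"
  proof (cases "x = 0")
    case True
    then show ?thesis using dual_apply_bound[of "F i j" x] by simp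
  next
    case False
    define y where "y = complex_of_real (1 / norm x) *\<^sub>C x"
    have "norm y = 1" using False by (simp add: y_def norm_scaleC norm_divide)
    then have "mnorm 1 (\<lambda>_ _. y) \<le> 1" by (simp only: mnorm_1)
    then have "pairing_norm n 1 F (\<lambda>_ _. y) \<le> mnorm n F" by (rule pairing_norm_le_mnorm)
    moreover have "cmod (dual_apply (F i j) y) \<le> pairing_norm n 1 F (\<lambda>_ _. y)"
      unfolding pairing_norm_def
      using opnorm_entry[of "{..<n} \<times> {..<1::nat}" "{..<n} \<times> {..<1::nat}" "(i, 0)" "(j, 0)"
          "\<lambda>(i, k) (j, l). dual_apply (F i j) y"] assms by simp
    ultimately have "cmod (dual_apply (F i j) y) \<le> mnorm n F" by linarith
    then show ?thesis using False
      by (simp add: y_def dual_apply_scaleC norm_mult norm_divide field_simps)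
  qed
qed (rule mnorm_dual_nonneg)

lemma mnorm_dual_scale_le:
  "mnorm n (\<lambda>i j. c *\<^sub>C F i j) \<le> cmod c * mnorm n F" for F :: "nat \<Rightarrow> nat \<Rightarrow> 'a dual"
proof (rule mnorm_dual_le)
  fix m and x :: "nat \<Rightarrow> nat \<Rightarrow> 'a" assume x: "mnorm m x \<le> 1"
  have scale: "dual_apply (c *\<^sub>C f) y = c * dual_apply f y" for f :: "'a dual" and y
    by transfer simp
  have "pairing_norm n m (\<lambda>i j. c *\<^sub>C F i j) x
     = opnorm ({..<n} \<times> {..<m}) ({..<n} \<times> {..<m}) (\<lambda>p q. c * (\<lambda>(i, k) (j, l). dual_apply (F i j) (x k l)) p q)"
    unfolding pairing_norm_def by (rule opnorm_cong) (auto simp: scale)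
  also have "\<dots> \<le> cmod c * pairing_norm n m F x"
    unfolding pairing_norm_def by (rule opnorm_scale_le) simp_all
  also have "\<dots> \<le> cmod c * mnorm n F"
    by (intro mult_left_mono pairing_norm_le_mnorm x) simp
  finally show "pairing_norm n m (\<lambda>i j. c *\<^sub>C F i j) x \<le> cmod c * mnorm n F" .
qed

instance
proof
  fix n m :: nat and F G :: "nat \<Rightarrow> nat \<Rightarrow> 'a dual" and c :: complex and f :: "'a dual"
    and \<alpha> \<beta> :: "nat \<Rightarrow> nat \<Rightarrow> complex"
  show "mnorm n F = mnorm n G" if eq: "\<And>i j. i < n \<Longrightarrow> j < n \<Longrightarrow> F i j = G i j"
  proof -
    have "pairing_norm n m F x = pairing_norm n m G x" for m x
      unfolding pairing_norm_def by (rule opnorm_cong) (auto simp: eq)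
    then show ?thesis by (simp only: mnorm_dual_def)
  qed
  show eq0: "mnorm n F = 0 \<longleftrightarrow> (\<forall>i<n. \<forall>j<n. F i j = 0)" for n and F :: "nat \<Rightarrow> nat \<Rightarrow> 'a dual"
  proof
    assume "mnorm n F = 0"
    then show "\<forall>i<n. \<forall>j<n. F i j = 0" using norm_le_mnorm_dual[of _ n _ F] by simp
  next
    assume 0: "\<forall>i<n. \<forall>j<n. F i j = 0"
    have "mnorm n F \<le> 0"
    proof (rule mnorm_dual_le)
      fix m and x :: "nat \<Rightarrow> nat \<Rightarrow> 'a"
      show "pairing_norm n m F x \<le> 0" using pairing_norm_le[of n m F x] 0 by simp
    qed
    then show "mnorm n F = 0" using mnorm_dual_nonneg[of n F] by simp
  qed
  show "mnorm n (\<lambda>i j. F i j + G i j) \<le> mnorm n F + mnorm n G"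
  proof (rule mnorm_dual_le)
    fix m and x :: "nat \<Rightarrow> nat \<Rightarrow> 'a" assume x: "mnorm m x \<le> 1"
    have add: "dual_apply (f + g) y = dual_apply f y + dual_apply g y" for f g :: "'a dual" and y
      by transfer simp
    have "pairing_norm n m (\<lambda>i j. F i j + G i j) x
      = opnorm ({..<n} \<times> {..<m}) ({..<n} \<times> {..<m}) (\<lambda>p q. (\<lambda>(i, k) (j, l). dual_apply (F i j) (x k l)) p q
          + (\<lambda>(i, k) (j, l). dual_apply (G i j) (x k l)) p q)"
      unfolding pairing_norm_def by (rule opnorm_cong) (auto simp: add)
    also have "\<dots> \<le> pairing_norm n m F x + pairing_norm n m G x"
      unfolding pairing_norm_def by (rule opnorm_triangle) simp_all
    also have "\<dots> \<le> mnorm n F + mnorm n G"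
      by (intro add_mono pairing_norm_le_mnorm x)
    finally show "pairing_norm n m (\<lambda>i j. F i j + G i j) x \<le> mnorm n F + mnorm n G" .
  qed
  show "mnorm n (\<lambda>i j. c *\<^sub>C F i j) = cmod c * mnorm n F"
  proof (cases "c = 0")
    case True
    then show ?thesis by (simp add: eq0)
  next
    case False
    have "F = (\<lambda>i j. (1/c) *\<^sub>C (c *\<^sub>C F i j))" using False by simp
    then have "mnorm n F \<le> cmod (1/c) * mnorm n (\<lambda>i j. c *\<^sub>C F i j)"
      using mnorm_dual_scale_le[of n "1/c" "\<lambda>i j. c *\<^sub>C F i j"] by simp
    then have "cmod c * mnorm n F \<le> mnorm n (\<lambda>i j. c *\<^sub>C F i j)"
      using False by (simp add: norm_divide field_simps)
    then show ?thesis using mnorm_dual_scale_le[of n c F] by simp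
  qed
  show "mnorm 1 (\<lambda>_ _. f) = norm f"
  proof (rule antisym)
    show "mnorm 1 (\<lambda>_ _. f) \<le> norm f"
    proof (rule mnorm_dual_le)
      fix m and x :: "nat \<Rightarrow> nat \<Rightarrow> 'a" assume x: "mnorm m x \<le> 1"
      have "pairing_norm 1 m (\<lambda>_ _. f) x \<le> norm f * mnorm m x"
        using pairing_norm_le[of 1 m "\<lambda>_ _. f" x] by simp
      also have "\<dots> \<le> norm f * 1" by (intro mult_left_mono x) simp
      finally show "pairing_norm 1 m (\<lambda>_ _. f) x \<le> norm f" by simp
    qed
    show "norm f \<le> mnorm 1 (\<lambda>_ _. f)"
      using norm_le_mnorm_dual[of 0 1 0 "\<lambda>_ _. f"] by simp
  qed
  show "mnorm (m + n) (dsum m F G) = max (mnorm m F) (mnorm n G)"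
  proof (rule antisym)
    show "mnorm (m + n) (dsum m F G) \<le> max (mnorm m F) (mnorm n G)"
    proof (rule mnorm_dual_le)
      fix r and x :: "nat \<Rightarrow> nat \<Rightarrow> 'a" assume "mnorm r x \<le> 1"
      then show "pairing_norm (m + n) r (dsum m F G) x \<le> max (mnorm m F) (mnorm n G)"
        unfolding pairing_norm_dsum by (intro max.mono pairing_norm_le_mnorm)
    qed
    have "max (pairing_norm m r F x) (pairing_norm n r G x) \<le> mnorm (m + n) (dsum m F G)"
      if "mnorm r x \<le> 1" for r and x :: "nat \<Rightarrow> nat \<Rightarrow> 'a"
      using pairing_norm_le_mnorm[OF that, of "m + n" "dsum m F G"] by (simp only: pairing_norm_dsum)
    then show "max (mnorm m F) (mnorm n G) \<le> mnorm (m + n) (dsum m F G)"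
      by (intro max.boundedI mnorm_dual_le) (simp_all only: max.bounded_iff)
  qed
  show "mnorm n (\<lambda>i j. \<Sum>k<m. \<Sum>l<m. (\<alpha> i k * \<beta> l j) *\<^sub>C F k l)
      \<le> opnorm {..<n} {..<m} \<alpha> * mnorm m F * opnorm {..<m} {..<n} \<beta>"
  proof (rule mnorm_dual_le)
    fix r and x :: "nat \<Rightarrow> nat \<Rightarrow> 'a" assume x: "mnorm r x \<le> 1"
    have "pairing_norm n r (\<lambda>i j. \<Sum>k<m. \<Sum>l<m. (\<alpha> i k * \<beta> l j) *\<^sub>C F k l) x
        \<le> opnorm {..<n} {..<m} \<alpha> * pairing_norm m r F x * opnorm {..<m} {..<n} \<beta>"
      by (rule pairing_norm_mult)
    also have "\<dots> \<le> opnorm {..<n} {..<m} \<alpha> * mnorm m F * opnorm {..<m} {..<n} \<beta>"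
      by (intro mult_right_mono mult_left_mono pairing_norm_le_mnorm x) (simp_all add: opnorm_nonneg)
    finally show "pairing_norm n r (\<lambda>i j. \<Sum>k<m. \<Sum>l<m. (\<alpha> i k * \<beta> l j) *\<^sub>C F k l) x
        \<le> opnorm {..<n} {..<m} \<alpha> * mnorm m F * opnorm {..<m} {..<n} \<beta>" .
  qed
qed

end

text \<open>The canonical embedding \<open>X \<rightarrow> X\<^sup>*\<^sup>*\<close>.\<close>

lift_definition canon :: "'a::complex_normed_vector \<Rightarrow> 'a dual dual" is "\<lambda>x f. dual_apply f x"
proof -
  fix x :: 'a
  have "bounded_linear (\<lambda>f. dual_apply f x)"
  proof (rule bounded_linear_intro)
    show "dual_apply (f + g) x = dual_apply f x + dual_apply g x" for f g by transfer simp
    show "dual_apply (r *\<^sub>R f) x = r *\<^sub>R dual_apply f x" for r f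
      unfolding scaleR_dual_def scaleR_conv_of_real by transfer simp
    show "norm (dual_apply f x) \<le> norm f * norm x" for f by (rule dual_apply_bound)
  qed
  moreover have "dual_apply (c *\<^sub>C f) x = c *\<^sub>C dual_apply f x" for c f
    unfolding scaleC_complex_def by transfer simp
  ultimately show "bounded_clinear (\<lambda>f. dual_apply f x)" by (simp add: bounded_clinear_iff)
qed

definition annihilator :: "'a::complex_normed_vector set \<Rightarrow> 'a dual set" where
  "annihilator J = {f. \<forall>x\<in>J. dual_apply f x = 0}"

text \<open>The adjoint \<open>Q\<^sup>*\<close>, meaningful for bounded complex-linear \<open>Q\<close>.\<close>

definition adj :: "('a::complex_normed_vector \<Rightarrow> 'b::complex_normed_vector) \<Rightarrow> 'b dual \<Rightarrow> 'a dual" where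
  "adj Q f = Abs_dual (\<lambda>x. dual_apply f (Q x))"


section \<open>One-sided M-projections, M-ideals and L-summands\<close>

text \<open>\<open>C\<^sub>2(X)\<close> and \<open>R\<^sub>2(X)\<close> have underlying space \<open>X \<times> X\<close> and the matrix norms they carry as the
  subspaces \<open>M\<^sub>2\<^sub>,\<^sub>1(X)\<close> and \<open>M\<^sub>1\<^sub>,\<^sub>2(X)\<close> of \<open>M\<^sub>2(X)\<close>. Thus \<open>M\<^sub>n(C\<^sub>2(X))\<close> is \<open>M\<^sub>2\<^sub>n\<^sub>,\<^sub>n(X)\<close>, which is padded with
  zeros to a square matrix; the rows are arranged here with all first components on top of all second
  components, a permutation that does not affect norms.\<close>

definition col2_mnorm :: "nat \<Rightarrow> (nat \<Rightarrow> nat \<Rightarrow> 'a::operator_space \<times> 'a) \<Rightarrow> real" where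
  "col2_mnorm n z = mnorm (2 * n)
     (\<lambda>i j. if j < n then (if i < n then fst (z i j) else snd (z (i - n) j)) else 0)"

definition row2_mnorm :: "nat \<Rightarrow> (nat \<Rightarrow> nat \<Rightarrow> 'a::operator_space \<times> 'a) \<Rightarrow> real" where
  "row2_mnorm n z = mnorm (2 * n)
     (\<lambda>i j. if i < n then (if j < n then fst (z i j) else snd (z i (j - n))) else 0)"

text \<open>Every amplification preserves the matrix norms. Linearity is not included; it is imposed on \<open>P\<close>
  below, and \<open>x \<mapsto> (P x, x - P x)\<close> inherits it.\<close>

definition completely_isometric ::
  "(nat \<Rightarrow> (nat \<Rightarrow> nat \<Rightarrow> 'a) \<Rightarrow> real) \<Rightarrow> (nat \<Rightarrow> (nat \<Rightarrow> nat \<Rightarrow> 'b) \<Rightarrow> real) \<Rightarrow> ('a \<Rightarrow> 'b) \<Rightarrow> bool" where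
  "completely_isometric N M T \<longleftrightarrow> (\<forall>n x. M n (\<lambda>i j. T (x i j)) = N n x)"

definition left_M_projection :: "('a::operator_space \<Rightarrow> 'a) \<Rightarrow> bool" where
  "left_M_projection P \<longleftrightarrow> clinear P \<and> P \<circ> P = P \<and>
     completely_isometric mnorm col2_mnorm (\<lambda>x. (P x, x - P x))"

definition right_M_projection :: "('a::operator_space \<Rightarrow> 'a) \<Rightarrow> bool" where
  "right_M_projection P \<longleftrightarrow> clinear P \<and> P \<circ> P = P \<and>
     completely_isometric mnorm row2_mnorm (\<lambda>x. (P x, x - P x))"

definition right_M_ideal :: "'a::operator_space set \<Rightarrow> bool" where
  "right_M_ideal J \<longleftrightarrow> complex_vector.subspace J \<and> closed J \<and>
     (\<exists>P. left_M_projection P \<and> range P = annihilator (annihilator J))"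

definition left_M_ideal :: "'a::operator_space set \<Rightarrow> bool" where
  "left_M_ideal J \<longleftrightarrow> complex_vector.subspace J \<and> closed J \<and>
     (\<exists>P. right_M_projection P \<and> range P = annihilator (annihilator J))"

definition right_L_projection :: "('a::operator_space \<Rightarrow> 'a) \<Rightarrow> bool" where
  "right_L_projection Q \<longleftrightarrow> bounded_clinear Q \<and> Q \<circ> Q = Q \<and> left_M_projection (adj Q)"

definition left_L_projection :: "('a::operator_space \<Rightarrow> 'a) \<Rightarrow> bool" where
  "left_L_projection Q \<longleftrightarrow> bounded_clinear Q \<and> Q \<circ> Q = Q \<and> right_M_projection (adj Q)"

definition left_L_summand :: "'a::operator_space set \<Rightarrow> bool" where
  "left_L_summand J \<longleftrightarrow> (\<exists>Q. right_L_projection Q \<and> range Q = J)"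

definition right_L_summand :: "'a::operator_space set \<Rightarrow> bool" where
  "right_L_summand J \<longleftrightarrow> (\<exists>Q. left_L_projection Q \<and> range Q = J)"

end

theory Submission
  imports Defs
begin

text \<open>Let \<open>\<pi>\<close> be the canonical projection of \<open>X\<^sup>*\<^sup>*\<^sup>*\<close> onto \<open>X\<^sup>*\<close>; its kernel is \<open>X\<^sup>\<bottom>\<close>, so \<open>\<pi>\<^sup>*\<close> is a
  contractive projection onto \<open>X\<^sup>\<bottom>\<^sup>\<bottom>\<close>. A left M-projection \<open>P\<close> satisfies
  \<open>\<parallel>x\<parallel>\<^sup>2 \<le> \<parallel>P x\<parallel>\<^sup>2 + \<parallel>x - P x\<parallel>\<^sup>2\<close>, and this estimate forces \<open>P\<close> to be the only contractive projection
  onto its range, and \<open>1 - P\<close> to be the only one onto the kernel of \<open>P\<close>. If \<open>X\<close> is a right M-ideal in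
  \<open>X\<^sup>*\<^sup>*\<close>, the first uniqueness gives \<open>\<pi>\<^sup>* = P\<close>, so \<open>\<pi>\<close> is a right L-projection. If moreover \<open>X\<^sup>*\<close> is
  the range of a left L-projection \<open>Q\<close>, then \<open>1 - Q\<^sup>*\<close> is a contractive projection onto the kernel of
  \<open>\<pi>\<^sup>*\<close>, so the second uniqueness gives \<open>Q\<^sup>* = \<pi>\<^sup>*\<close>, and \<open>X\<close> is a left M-ideal in \<open>X\<^sup>*\<^sup>*\<close>.\<close>

section \<open>Uniqueness of contractive projections\<close>

text \<open>\<open>F\<close> fixes \<open>range E\<close>, so it remains to show that
  \<open>F\<close> kills the kernel of \<open>E\<close>. If \<open>y\<close> is in that kernel and
  \<open>z = F y\<close> were nonzero, moving \<open>y\<close> far in the direction of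
  \<open>z\<close> would make \<open>F\<close> expand.\<close>

lemma contractive_projection_unique:
  fixes E F :: "'a::real_normed_vector \<Rightarrow> 'a"
  assumes E: "linear E" "E \<circ> E = E" "\<And>x. (norm x)\<^sup>2 \<le> (norm (E x))\<^sup>2 + (norm (x - E x))\<^sup>2"
    and F: "linear F" "F \<circ> F = F" "\<And>x. norm (F x) \<le> norm x"
    and range: "range F = range E"
  shows "F = E"
proof
  fix x
  have EE: "E (E u) = E u" and FF: "F (F u) = F u" for u
    using E(2) F(2) by (simp_all add: fun_eq_iff)
  have EF: "E (F u) = F u" and FE: "F (E u) = E u" for u
  proof -
    have "F u \<in> range E" "E u \<in> range F" using range by blast+
    then obtain v w where "F u = E v" "E u = F w" by blast
    then show "E (F u) = F u" "F (E u) = E u" using EE FF by simp_all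
  qed
  define y where "y = x - E x"
  define z where "z = F y"
  have Ey: "E y = 0" by (simp add: y_def linear_diff[OF E(1)] EE)
  have Ez: "E z = z" and Fz: "F z = z" by (simp_all add: z_def EF FF)
  \<comment> \<open>Test vector \<open>y + n z\<close>: \<open>F\<close> sends it to
    \<open>(n + 1) z\<close>, while \<open>E\<close> splits it into \<open>n z\<close> and
    \<open>y\<close>. Contractivity and the estimate for \<open>E\<close> give \<open>(n +
    1)\<^sup>2 * (norm z)\<^sup>2 \<le> n\<^sup>2 * (norm z)\<^sup>2 + (norm
    y)\<^sup>2\<close>.\<close>
  have le: "(2 * real n + 1) * (norm z)\<^sup>2 \<le> (norm y)\<^sup>2" for n
  proof -
    have "F (y + real n *\<^sub>R z) = (real n + 1) *\<^sub>R z"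
      by (simp add: linear_add[OF F(1)] linear_scale[OF F(1)] Fz z_def[symmetric] algebra_simps)
    then have "(real n + 1) * norm z \<le> norm (y + real n *\<^sub>R z)"
      using F(3)[of "y + real n *\<^sub>R z"] by simp
    then have "((real n + 1) * norm z)\<^sup>2 \<le> (norm (y + real n *\<^sub>R z))\<^sup>2"
      by (intro power_mono) simp_all
    also have "E (y + real n *\<^sub>R z) = real n *\<^sub>R z"
      by (simp add: linear_add[OF E(1)] linear_scale[OF E(1)] Ey Ez)
    then have "(norm (y + real n *\<^sub>R z))\<^sup>2 \<le> (real n * norm z)\<^sup>2 + (norm y)\<^sup>2"
      using E(3)[of "y + real n *\<^sub>R z"] by simp
    finally show ?thesis by (simp add: power2_eq_square algebra_simps)
  qed
  have "z = 0"
  proof (rule ccontr)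
    assume "z \<noteq> 0"
    then have pos: "(norm z)\<^sup>2 > 0" by simp
    obtain n where "(norm y)\<^sup>2 < real n * (norm z)\<^sup>2"
      using reals_Archimedean3[OF pos] by blast
    moreover have "real n * (norm z)\<^sup>2 \<le> (2 * real n + 1) * (norm z)\<^sup>2"
      by (rule mult_right_mono) simp_all
    ultimately show False using le[of n] by linarith
  qed
  then have "F x - F (E x) = 0"
    by (simp add: z_def y_def linear_diff[OF F(1)])
  then show "F x = E x" by (simp add: FE)
qed


section \<open>Norm estimates for one-sided M-projections\<close>

lemma clinear_imp_linear: "clinear f \<Longrightarrow> linear f"
  by (rule linearI) (simp_all add: clinear_iff flip: scaleC_of_real)

text \<open>Division by zero yields zero, so \<open>a = 0\<close> is covered and the factorization
  below needs no case split.\<close>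

lemma norm_scaleC_normalize: "complex_of_real (norm a) *\<^sub>C (complex_of_real (1 / norm a) *\<^sub>C a) = a"
  for a :: "'a::complex_normed_vector"
  by (cases "a = 0") (simp_all add: scaleC_scaleC)

text \<open>The column with entries \<open>a\<close>, \<open>b\<close> is the diagonal matrix of the
  normalized entries times the scalar column \<open>(norm a, norm b)\<close>. The first factor has
  norm at most 1, the second is bounded by its Euclidean length.\<close>

lemma col2_mnorm_le:
  fixes a b :: "'a::operator_space"
  shows "(col2_mnorm 1 (\<lambda>_ _. (a, b)))\<^sup>2 \<le> (norm a)\<^sup>2 + (norm b)\<^sup>2"
proof -
  define a' b' where "a' = complex_of_real (1 / norm a) *\<^sub>C a" and "b' = complex_of_real (1 / norm b) *\<^sub>C b"
  have a': "complex_of_real (norm a) *\<^sub>C a' = a" and b': "complex_of_real (norm b) *\<^sub>C b' = b"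
    unfolding a'_def b'_def by (rule norm_scaleC_normalize)+
  define w where "w = (\<lambda>i::nat. complex_of_real (if i = 0 then norm a else norm b))"
  define D where "D = dsum 1 (\<lambda>_ _. a') (\<lambda>_ _. b')"
  \<comment> \<open>\<open>mnorm_mult\<close> multiplies on both sides: \<open>\<alpha>\<close> is
    the identity, and \<open>\<beta>\<close> is the scalar column \<open>w\<close> padded by a zero
    column to match \<open>col2_mnorm\<close>.\<close>
  define \<alpha> where "\<alpha> = (\<lambda>i k::nat. if i = k then 1 else 0 :: complex)"
  define \<beta> where "\<beta> = (\<lambda>l j::nat. if j = 0 then w l else 0)"
  have sums: "(\<Sum>k<2. g k) = g 0 + g 1" for g :: "nat \<Rightarrow> 'b::comm_monoid_add"
    by (simp add: numeral_2_eq_2)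
  have L2_2: "L2_set g {..<2::nat} = sqrt ((g 0)\<^sup>2 + (g 1)\<^sup>2)" for g
    by (simp add: L2_set_def sums)
  have "mnorm (1 + 1) D = max (norm a') (norm b')"
    unfolding D_def mnorm_dsum mnorm_1 ..
  also have "\<dots> \<le> 1" by (simp add: a'_def b'_def norm_scaleC norm_divide)
  finally have D: "mnorm 2 D \<le> 1" by (simp add: numeral_2_eq_2)
  have \<alpha>: "opnorm {..<2} {..<2} \<alpha> \<le> 1"
    by (rule opnorm_le) (simp_all add: L2_2 sums \<alpha>_def)
  have \<beta>: "opnorm {..<2} {..<2} \<beta> \<le> sqrt ((norm a)\<^sup>2 + (norm b)\<^sup>2)"
  proof (rule opnorm_le)
    fix v :: "nat \<Rightarrow> complex"
    have "L2_set (\<lambda>i. cmod (\<Sum>j<2. \<beta> i j * v j)) {..<2} = sqrt (((norm a)\<^sup>2 + (norm b)\<^sup>2) * (cmod (v 0))\<^sup>2)"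
      by (simp add: L2_2 sums \<beta>_def w_def norm_mult algebra_simps)
    also have "\<dots> \<le> sqrt (((norm a)\<^sup>2 + (norm b)\<^sup>2) * ((cmod (v 0))\<^sup>2 + (cmod (v 1))\<^sup>2))"
      by (intro real_sqrt_le_mono mult_left_mono) simp_all
    finally show "L2_set (\<lambda>i. cmod (\<Sum>j<2. \<beta> i j * v j)) {..<2}
        \<le> sqrt ((norm a)\<^sup>2 + (norm b)\<^sup>2) * L2_set (\<lambda>j. cmod (v j)) {..<2}"
      by (simp add: L2_2 real_sqrt_mult)
  qed simp
  have "col2_mnorm 1 (\<lambda>_ _. (a, b)) = mnorm 2 (\<lambda>i j. \<Sum>k<2. \<Sum>l<2. (\<alpha> i k * \<beta> l j) *\<^sub>C D k l)"
    unfolding col2_mnorm_def mult_1_right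
  proof (rule mnorm_cong)
    fix i j :: nat assume "i < 2" "j < 2"
    then have "i = 0 \<or> i = 1" "j = 0 \<or> j = 1" by auto
    then show "(if j < 1 then if i < 1 then fst (a, b) else snd (a, b) else 0)
        = (\<Sum>k<2. \<Sum>l<2. (\<alpha> i k * \<beta> l j) *\<^sub>C D k l)"
      by (elim disjE) (simp_all add: sums \<alpha>_def \<beta>_def w_def D_def dsum_def a' b')
  qed
  also have "\<dots> \<le> opnorm {..<2} {..<2} \<alpha> * mnorm 2 D * opnorm {..<2} {..<2} \<beta>"
    by (rule mnorm_mult)
  also have "\<dots> \<le> 1 * 1 * sqrt ((norm a)\<^sup>2 + (norm b)\<^sup>2)"
    by (intro mult_mono \<alpha> D \<beta>) (simp_all add: mnorm_nonneg opnorm_nonneg)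
  finally have "col2_mnorm 1 (\<lambda>_ _. (a, b)) \<le> sqrt ((norm a)\<^sup>2 + (norm b)\<^sup>2)" by simp
  moreover have "0 \<le> col2_mnorm 1 (\<lambda>_ _. (a, b))"
    by (simp add: col2_mnorm_def mnorm_nonneg)
  ultimately have "(col2_mnorm 1 (\<lambda>_ _. (a, b)))\<^sup>2 \<le> (sqrt ((norm a)\<^sup>2 + (norm b)\<^sup>2))\<^sup>2"
    by (rule power_mono)
  then show ?thesis by simp
qed

text \<open>\<open>b\<close> is the entry at position (0, 1) of the padded matrix, so it is cut out
  by a unit row on the left and a unit column on the right, both of norm at most 1.\<close>

lemma norm_snd_le_row2_mnorm:
  fixes a b :: "'a::operator_space"
  shows "norm b \<le> row2_mnorm 1 (\<lambda>_ _. (a, b))"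
proof -
  define M where "M = (\<lambda>i j::nat. if i < (1::nat) then (if j < 1 then a else b) else 0)"
  define e where "e = (\<lambda>n k::nat. if k = n then 1 else 0 :: complex)"
  have e: "L2_set (\<lambda>k. cmod (e 0 k)) {..<2} = 1" "L2_set (\<lambda>k. cmod (e 1 k)) {..<2} = 1"
    by (simp_all add: L2_set_def e_def numeral_2_eq_2)
  have M: "row2_mnorm 1 (\<lambda>_ _. (a, b)) = mnorm 2 M"
    unfolding row2_mnorm_def mult_1_right by (rule mnorm_cong) (simp add: M_def)
  have "b = (\<Sum>k<2. \<Sum>l<2. (e 0 k * e 1 l) *\<^sub>C M k l)"
    by (simp add: e_def M_def numeral_2_eq_2)
  then have "norm b = mnorm 1 (\<lambda>i j. \<Sum>k<2. \<Sum>l<2. (e 0 k * e 1 l) *\<^sub>C M k l)"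
    by (simp only: mnorm_1)
  also have "\<dots> \<le> opnorm {..<1::nat} {..<2} (\<lambda>i. e 0) * mnorm 2 M * opnorm {..<2} {..<1::nat} (\<lambda>l j. e 1 l)"
    by (rule mnorm_mult)
  also have "\<dots> \<le> 1 * mnorm 2 M * 1"
    using opnorm_row_le[of "{..<2}" "e 0"] opnorm_col_le[of "{..<2}" "e 1"] unfolding e
    by (intro mult_mono) (simp_all add: mnorm_nonneg opnorm_nonneg)
  finally show ?thesis by (simp only: M mult_1_left mult_1_right)
qed

lemma left_M_projection_norm_le:
  assumes "left_M_projection P"
  shows "(norm x)\<^sup>2 \<le> (norm (P x))\<^sup>2 + (norm (x - P x))\<^sup>2"
proof -
  have "col2_mnorm 1 (\<lambda>_ _. (P x, x - P x)) = mnorm 1 (\<lambda>_ _. x)"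
    using assms[unfolded left_M_projection_def completely_isometric_def, THEN conjunct2, THEN conjunct2,
        THEN spec[of _ 1], THEN spec[of _ "\<lambda>_ _. x"]] .
  then show ?thesis using col2_mnorm_le[of "P x" "x - P x"] by (simp only: mnorm_1)
qed

lemma right_M_projection_complement_contractive:
  assumes "right_M_projection P"
  shows "norm (x - P x) \<le> norm x"
proof -
  have "row2_mnorm 1 (\<lambda>_ _. (P x, x - P x)) = mnorm 1 (\<lambda>_ _. x)"
    using assms[unfolded right_M_projection_def completely_isometric_def, THEN conjunct2, THEN conjunct2,
        THEN spec[of _ 1], THEN spec[of _ "\<lambda>_ _. x"]] .
  then show ?thesis using norm_snd_le_row2_mnorm[of "x - P x" "P x"] by (simp only: mnorm_1)
qed

lemma left_M_projection_eq_contractive: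
  assumes "left_M_projection P" "linear F" "F \<circ> F = F" "\<And>x. norm (F x) \<le> norm x" "range F = range P"
  shows "F = P"
proof (rule contractive_projection_unique[OF _ _ left_M_projection_norm_le[OF assms(1)] assms(2-5)])
  show "linear P" "P \<circ> P = P"
    using assms(1) by (simp_all add: left_M_projection_def clinear_imp_linear)
qed

text \<open>Equal kernels mean that \<open>1 - P\<close> and \<open>1 - P'\<close> have equal
  ranges. The squared estimate for \<open>P\<close> is symmetric in \<open>P\<close> and
  \<open>1 - P\<close>, and \<open>1 - P'\<close> is contractive, so uniqueness applies to the
  complements.\<close>

lemma left_right_M_projection_eq:
  assumes P: "left_M_projection P" and P': "right_M_projection P'"
    and ker: "\<And>x. P x = 0 \<longleftrightarrow> P' x = 0"
  shows "P' = P"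
proof -
  have lin: "linear P" "linear P'"
    using P P' by (simp_all add: left_M_projection_def right_M_projection_def clinear_imp_linear)
  have idem: "P (P x) = P x" "P' (P' x) = P' x" for x
    using P P' by (simp_all add: left_M_projection_def right_M_projection_def fun_eq_iff)
  have cross: "P (x - P' x) = 0" "P' (x - P x) = 0" for x
    using ker[of "x - P' x"] ker[of "x - P x"]
    by (simp_all add: linear_diff[OF lin(1)] linear_diff[OF lin(2)] idem)
  have "(\<lambda>x. x - P' x) = (\<lambda>x. x - P x)"
  proof (rule contractive_projection_unique)
    show "linear (\<lambda>x. x - P x)" "linear (\<lambda>x. x - P' x)"
      using lin by (auto intro: linear_compose_sub linear_ident)
    show "(\<lambda>x. x - P x) \<circ> (\<lambda>x. x - P x) = (\<lambda>x. x - P x)"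
      "(\<lambda>x. x - P' x) \<circ> (\<lambda>x. x - P' x) = (\<lambda>x. x - P' x)"
      by (simp_all add: fun_eq_iff linear_diff[OF lin(1)] linear_diff[OF lin(2)] idem)
    show "(norm x)\<^sup>2 \<le> (norm (x - P x))\<^sup>2 + (norm (x - (x - P x)))\<^sup>2" for x
      using left_M_projection_norm_le[OF P, of x] by simp
    show "norm (x - P' x) \<le> norm x" for x
      by (rule right_M_projection_complement_contractive[OF P'])
    show "range (\<lambda>x. x - P' x) = range (\<lambda>x. x - P x)"
    proof (intro antisym image_subsetI)
      show "x - P' x \<in> range (\<lambda>x. x - P x)" for x
        by (rule image_eqI[of _ _ "x - P' x"]) (simp_all add: cross)
      show "x - P x \<in> range (\<lambda>x. x - P' x)" for x
        by (rule image_eqI[of _ _ "x - P x"]) (simp_all add: cross)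
    qed
  qed
  then show ?thesis by (simp add: fun_eq_iff)
qed


section \<open>Adjoints and the canonical projection\<close>

lemma dual_apply_adj: "bounded_clinear Q \<Longrightarrow> dual_apply (adj Q f) x = dual_apply f (Q x)"
  unfolding adj_def
  using bounded_clinear_dual_apply[of f] bounded_linear_compose[of "dual_apply f" Q]
  by (subst Abs_dual_inverse) (auto simp: bounded_clinear_iff)

lemma dual_apply_0_right: "dual_apply f 0 = 0"
  by (rule linear_0[OF bounded_linear.linear[OF bounded_linear_dual_apply]])

lemma dual_apply_diff_right: "dual_apply f (x - y) = dual_apply f x - dual_apply f y"
  by (rule linear_diff[OF bounded_linear.linear[OF bounded_linear_dual_apply]])

lemma bounded_clinear_adj:
  assumes "bounded_clinear Q"
  shows "bounded_clinear (adj Q)"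
  unfolding bounded_clinear_iff
proof (intro conjI allI)
  obtain K where K: "0 \<le> K" "\<And>x. norm (Q x) \<le> norm x * K"
    using assms bounded_linear.nonneg_bounded by (auto simp: bounded_clinear_def)
  show scaleC: "adj Q (c *\<^sub>C f) = c *\<^sub>C adj Q f" for c f
    by (rule dual_eqI) (simp add: dual_apply_adj[OF assms] scaleC_dual.rep_eq)
  show "bounded_linear (adj Q)"
  proof (rule bounded_linear_intro)
    show "adj Q (f + g) = adj Q f + adj Q g" for f g
      by (rule dual_eqI) (simp add: dual_apply_adj[OF assms] plus_dual.rep_eq)
    show "adj Q (r *\<^sub>R f) = r *\<^sub>R adj Q f" for r f
      using scaleC[of "complex_of_real r" f] by (simp add: scaleC_of_real)
    show "norm (adj Q f) \<le> norm f * K" for f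
      unfolding norm_dual.rep_eq[of "adj Q f"]
    proof (rule onorm_bound)
      fix x
      have "norm (dual_apply (adj Q f) x) \<le> norm f * norm (Q x)"
        by (simp add: dual_apply_adj[OF assms] dual_apply_bound)
      also have "\<dots> \<le> norm f * (norm x * K)" by (intro mult_left_mono K) simp
      finally show "norm (dual_apply (adj Q f) x) \<le> norm f * K * norm x" by (simp add: mult_ac)
    qed (simp add: K)
  qed
qed

lemma norm_adj_le:
  assumes "bounded_clinear Q" "\<And>x. norm (Q x) \<le> norm x"
  shows "norm (adj Q f) \<le> norm f"
  unfolding norm_dual.rep_eq[of "adj Q f"]
proof (rule onorm_bound)
  fix x
  show "norm (dual_apply (adj Q f) x) \<le> norm f * norm x"
    using order_trans[OF dual_apply_bound mult_left_mono[OF assms(2)[of x]], of f]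
    by (simp add: dual_apply_adj[OF assms(1)])
qed simp

lemma adj_idem:
  assumes "bounded_clinear Q" "Q \<circ> Q = Q"
  shows "adj Q \<circ> adj Q = adj Q"
  using fun_cong[OF assms(2)] by (auto intro!: ext dual_eqI simp: dual_apply_adj[OF assms(1)])

lemma adj_eq_0_iff:
  assumes "bounded_clinear Q"
  shows "adj Q f = 0 \<longleftrightarrow> f \<in> annihilator (range Q)"
proof -
  have "adj Q f = 0 \<longleftrightarrow> (\<forall>x. dual_apply (adj Q f) x = dual_apply 0 x)"
    by (auto intro: dual_eqI)
  then show ?thesis
    by (simp add: dual_apply_adj[OF assms] zero_dual.rep_eq annihilator_def)
qed

text \<open>Since \<open>x - Q x\<close> lies in the kernel of \<open>Q\<close>, a functional
  vanishing there satisfies \<open>f x = f (Q x)\<close>, that is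
  \<open>f = adj Q f\<close>.\<close>

lemma range_adj_projection:
  assumes "bounded_clinear Q" "Q \<circ> Q = Q"
  shows "range (adj Q) = annihilator {x. Q x = 0}"
proof
  show "range (adj Q) \<subseteq> annihilator {x. Q x = 0}"
    by (auto simp: annihilator_def dual_apply_adj[OF assms(1)] dual_apply_0_right)
  show "annihilator {x. Q x = 0} \<subseteq> range (adj Q)"
  proof
    fix f assume f: "f \<in> annihilator {x. Q x = 0}"
    have "linear Q" using assms(1) by (simp add: bounded_clinear_def clinear_imp_linear)
    then have "Q (x - Q x) = 0" for x
      using fun_cong[OF assms(2), of x] by (simp add: linear_diff)
    then have "dual_apply f (x - Q x) = 0" for x
      using f by (simp add: annihilator_def)
    then have "f = adj Q f"
      by (intro dual_eqI) (simp add: dual_apply_adj[OF assms(1)] dual_apply_diff_right)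
    then show "f \<in> range (adj Q)" by blast
  qed
qed

lemma norm_canon_le: "norm (canon x) \<le> norm x"
  unfolding norm_dual.rep_eq
  by (rule onorm_bound) (simp_all add: canon.rep_eq dual_apply_bound mult.commute[of "norm x"])

lemma bounded_clinear_canon: "bounded_clinear (canon :: 'a::complex_normed_vector \<Rightarrow> 'a dual dual)"
  unfolding bounded_clinear_iff
proof (intro conjI allI)
  show scaleC: "canon (c *\<^sub>C x) = c *\<^sub>C canon x" for c and x :: 'a
    by (rule dual_eqI) (simp add: canon.rep_eq scaleC_dual.rep_eq dual_apply_scaleC)
  show "bounded_linear (canon :: 'a \<Rightarrow> 'a dual dual)"
  proof (rule bounded_linear_intro)
    show "canon (x + y) = canon x + canon y" for x y :: 'a
      by (rule dual_eqI)
        (simp add: canon.rep_eq plus_dual.rep_eq linear_add[OF bounded_linear.linear[OF bounded_linear_dual_apply]])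
    show "canon (r *\<^sub>R x) = r *\<^sub>R canon x" for r and x :: 'a
      using scaleC[of "complex_of_real r" x] by (simp add: scaleC_of_real)
    show "norm (canon x) \<le> norm x * 1" for x :: 'a by (simp add: norm_canon_le)
  qed
qed

text \<open>Here the inner \<open>canon\<close> embeds the dual, while \<open>adj canon\<close>
  restricts functionals on the second dual to the original space.\<close>

lemma adj_canon_canon: "adj canon (canon f) = f" for f :: "'a::complex_normed_vector dual"
  by (rule dual_eqI) (simp add: dual_apply_adj[OF bounded_clinear_canon] canon.rep_eq)

text \<open>This is \<open>\<pi>\<close> of the overview: restrict to the canonical copy of the
  space, then embed the restriction into the third dual.\<close>

definition canonical_projection ::
  "'a::complex_normed_vector dual dual dual \<Rightarrow> 'a dual dual dual" where
  "canonical_projection = canon \<circ> adj canon"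

lemma bounded_clinear_canonical_projection: "bounded_clinear canonical_projection"
  using bounded_clinear_canon bounded_clinear_adj[OF bounded_clinear_canon]
  unfolding canonical_projection_def bounded_clinear_iff
  by (auto simp: o_def intro: bounded_linear_compose)

lemma canonical_projection_idem: "canonical_projection \<circ> canonical_projection = canonical_projection"
  by (simp add: canonical_projection_def fun_eq_iff adj_canon_canon)

lemma norm_canonical_projection_le: "norm (canonical_projection f) \<le> norm f"
  using order_trans[OF norm_canon_le norm_adj_le[OF bounded_clinear_canon norm_canon_le]]
  by (simp add: canonical_projection_def)

lemma range_canonical_projection: "range canonical_projection = range canon"
proof -
  have "canon f = canonical_projection (canon f)" for f :: "'a dual"
    by (simp add: canonical_projection_def adj_canon_canon)
  then show ?thesis by (auto simp: canonical_projection_def)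
qed

text \<open>The outer \<open>canon\<close> has the left inverse \<open>adj canon\<close>, so only
  the kernel of the restriction map matters.\<close>

lemma canonical_projection_eq_0_iff:
  "canonical_projection f = 0 \<longleftrightarrow> f \<in> annihilator (range canon)"
proof -
  have "canonical_projection f = 0 \<longleftrightarrow> adj canon f = 0"
  proof
    assume "canonical_projection f = 0"
    then have "adj canon (canon (adj canon f)) = adj canon 0"
      by (simp add: canonical_projection_def)
    also have "\<dots> = 0"
      by (rule dual_eqI) (simp add: dual_apply_adj[OF bounded_clinear_canon] zero_dual.rep_eq dual_apply_0_right)
    finally show "adj canon f = 0" by (simp add: adj_canon_canon)
  next
    assume "adj canon f = 0"
    moreover have "canon 0 = (0 :: 'a dual dual dual)"
      by (rule dual_eqI) (simp add: canon.rep_eq zero_dual.rep_eq dual_apply_0_right)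
    ultimately show "canonical_projection f = 0" by (simp add: canonical_projection_def)
  qed
  then show ?thesis by (simp add: adj_eq_0_iff[OF bounded_clinear_canon])
qed

lemma range_adj_canonical_projection:
  "range (adj canonical_projection) = annihilator (annihilator (range canon))"
  by (simp add: range_adj_projection[OF bounded_clinear_canonical_projection canonical_projection_idem]
      canonical_projection_eq_0_iff)

theorem lemma6p8:
  assumes "right_M_ideal (range (canon :: 'a::operator_space \<Rightarrow> 'a dual dual))"
    and "\<not> left_M_ideal (range (canon :: 'a \<Rightarrow> 'a dual dual))"
  shows "left_L_summand (range (canon :: 'a dual \<Rightarrow> 'a dual dual dual)) \<and>
    \<not> right_L_summand (range (canon :: 'a dual \<Rightarrow> 'a dual dual dual))"
proof
  let ?\<pi> = "canonical_projection :: 'a dual dual dual \<Rightarrow> 'a dual dual dual"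
  note bc = bounded_clinear_canonical_projection[where 'a='a]
  obtain P where P: "left_M_projection P" "range P = annihilator (annihilator (range (canon :: 'a \<Rightarrow> 'a dual dual)))"
    using assms(1) unfolding right_M_ideal_def by blast
  have "adj ?\<pi> = P"
  proof (rule left_M_projection_eq_contractive[OF P(1)])
    show "linear (adj ?\<pi>)"
      using bounded_clinear_adj[OF bc] by (simp add: bounded_clinear_def clinear_imp_linear)
    show "adj ?\<pi> \<circ> adj ?\<pi> = adj ?\<pi>"
      by (rule adj_idem[OF bc canonical_projection_idem])
    show "norm (adj ?\<pi> x) \<le> norm x" for x
      by (rule norm_adj_le[OF bc norm_canonical_projection_le])
    show "range (adj ?\<pi>) = range P"
      by (simp only: range_adj_canonical_projection P(2))
  qed
  then have left: "left_M_projection (adj ?\<pi>)" using P(1) by simp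
  then have "right_L_projection ?\<pi>"
    by (simp add: right_L_projection_def bc canonical_projection_idem)
  then show "left_L_summand (range (canon :: 'a dual \<Rightarrow> 'a dual dual dual))"
    unfolding left_L_summand_def using range_canonical_projection by blast
  show "\<not> right_L_summand (range (canon :: 'a dual \<Rightarrow> 'a dual dual dual))"
  proof
    assume "right_L_summand (range (canon :: 'a dual \<Rightarrow> 'a dual dual dual))"
    then obtain Q where Q: "bounded_clinear Q" "right_M_projection (adj Q)"
        "range Q = range (canon :: 'a dual \<Rightarrow> 'a dual dual dual)"
      unfolding right_L_summand_def left_L_projection_def by blast
    \<comment> \<open>The kernel of an adjoint is the annihilator of the range, and \<open>Q\<close>
      and \<open>?\<pi>\<close> share the range \<open>range canon\<close>.\<close>
    have "adj Q = adj ?\<pi>"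
      by (rule left_right_M_projection_eq[OF left Q(2)])
        (simp add: adj_eq_0_iff[OF bc] adj_eq_0_iff[OF Q(1)] Q(3) range_canonical_projection)
    then have "right_M_projection (adj ?\<pi>)" using Q(2) by simp
    \<comment> \<open>\<open>adj ?\<pi>\<close> is the witness; that \<open>range canon\<close> is a
      closed subspace is already part of the first assumption.\<close>
    then have "left_M_ideal (range (canon :: 'a \<Rightarrow> 'a dual dual))"
      using assms(1) range_adj_canonical_projection[where 'a='a]
      unfolding right_M_ideal_def left_M_ideal_def by blast
    then show False using assms(2) by contradiction
  qed
qed

end
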